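(* Fix an integer $n\ge 2$, and let $\Psi:\mathbb{K}\to\mathbb{E}_0$ be a map from the set $\mathbb{K}$ of strongly convex, smoothly bounded open neighborhoods of $0\in\mathbb{C}^n$ to the set $\mathbb{E}_0$ of hermitian ellipsoids in $\mathbb{C}^n$. Suppose $\Psi$ is $\mathrm{GL}_n(\mathbb{C})$ equivariant: $$\Psi(AY)=A(\Psi(Y))$$ whenever $Y\in\mathbb{K}$ and $A:\mathbb{C}^n\to\mathbb{C}^n$ is linear and invertible. Then there are a complex manifold $S$ and a pseudoconvex family $X\subset S\times\mathbb{C}^n$ all of whose fibers $X[s]$, $s\in S$, are in $\mathbb{K}$, but such that $$\bigcup_{s\in S}\big(\{s\}\times\Psi(X[s])\big)\subset S\times\mathbb{C}^n$$ is not a pseudoconvex family.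
   Context: $\mathbb{E}_0$ denotes the set of hermitian ellipsoids in $\mathbb{C}^n$, i.e. the images of the open unit ball of $\mathbb{C}^n$ under invertible complex linear maps $\mathbb{C}^n\to\mathbb{C}^n$. Elements of $\mathbb{K}$ are bounded open sets with $C^\infty$ boundary containing $0$; strong convexity means that they are convex and the normal curvatures of the boundary are positive. For a complex manifold $S$, an open set $X\subset S\times\mathbb{C}^n$ and $s\in S$, the fiber is $X[s]=\{x\in\mathbb{C}^n:(s,x)\in X\}$. A family of pseudoconvex open sets over $S$ is an open set $X\subset S\times\mathbb{C}^n$ that contains $S\times\{0\}$ and such that each fiber $X[s]$, $s\in S$, is pseudoconvex. It is called a pseudoconvex family if in addition $X$ is a Stein manifold. *)

theory Defs
  imports "HOL-Complex_Analysis.Complex_Analysis"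
begin

section \<open>Complex manifolds\<close>

text \<open>
  The coordinate space \<open>\<complex>\<^sup>I\<close>, for a finite index set \<open>I\<close>. Working with index sets instead of index
  types allows the dimension of a manifold to be quantified over. Points are functions that are
  \<^const>\<open>undefined\<close> outside \<open>I\<close>.
\<close>

definition cspace :: "'i set \<Rightarrow> ('i \<Rightarrow> complex) topology" where
  "cspace I = product_topology (\<lambda>_. euclidean) I"

text \<open>Holomorphic functions of several variables: continuous, and holomorphic in each variable.\<close>

definition holo_on :: "'i set \<Rightarrow> ('i \<Rightarrow> complex) set \<Rightarrow> (('i \<Rightarrow> complex) \<Rightarrow> complex) \<Rightarrow> bool" where
  "holo_on I D f \<longleftrightarrow>
     openin (cspace I) D \<and>
     continuous_map (subtopology (cspace I) D) euclidean f \<and>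
     (\<forall>z\<in>D. \<forall>i\<in>I. (\<lambda>w. f (z(i := w))) field_differentiable (at (z i)))"

type_synonym ('a, 'i) chart = "'a set \<times> ('a \<Rightarrow> 'i \<Rightarrow> complex)"

text \<open>
  A manifold is carried by a subset of a type, with an arbitrary topology on it. Since a second
  countable manifold has at most continuum many points, every equidimensional complex manifold is isomorphic to one
  whose points are of type \<^typ>\<open>nat \<Rightarrow> complex\<close> and whose coordinates are indexed by natural numbers.
\<close>

record ('a, 'i) cmfd =
  mtop :: "'a topology"
  midx :: "'i set"
  atlas :: "('a, 'i) chart set"

abbreviation points :: "('a, 'i) cmfd \<Rightarrow> 'a set" where
  "points M \<equiv> topspace (mtop M)"

definition is_chart :: "'a topology \<Rightarrow> 'i set \<Rightarrow> ('a, 'i) chart \<Rightarrow> bool" where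
  "is_chart T I = (\<lambda>(U, \<phi>).
     openin T U \<and> openin (cspace I) (\<phi> ` U) \<and>
     homeomorphic_map (subtopology T U) (subtopology (cspace I) (\<phi> ` U)) \<phi>)"

definition holo_transition :: "'i set \<Rightarrow> ('a, 'i) chart \<Rightarrow> ('a, 'i) chart \<Rightarrow> bool" where
  "holo_transition I = (\<lambda>(U, \<phi>) (V, \<psi>).
     \<forall>i\<in>I. holo_on I (\<phi> ` (U \<inter> V)) (\<lambda>z. \<psi> (inv_into U \<phi> z) i))"

definition complex_manifold :: "('a, 'i) cmfd \<Rightarrow> bool" where
  "complex_manifold M \<longleftrightarrow>
     finite (midx M) \<and>
     Hausdorff_space (mtop M) \<and> second_countable (mtop M) \<and>
     \<Union> (fst ` atlas M) = points M \<and>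
     (\<forall>c\<in>atlas M. is_chart (mtop M) (midx M) c) \<and>
     (\<forall>c\<in>atlas M. \<forall>d\<in>atlas M. holo_transition (midx M) c d)"

definition holo_functions :: "('a, 'i) cmfd \<Rightarrow> ('a \<Rightarrow> complex) set" where
  "holo_functions M =
     {f. \<forall>(U, \<phi>)\<in>atlas M. holo_on (midx M) (\<phi> ` U) (\<lambda>z. f (inv_into U \<phi> z))}"

definition open_submanifold :: "('a, 'i) cmfd \<Rightarrow> 'a set \<Rightarrow> ('a, 'i) cmfd" where
  "open_submanifold M X =
     \<lparr> mtop = subtopology (mtop M) X,
       midx = midx M,
       atlas = (\<lambda>(U, \<phi>). (U \<inter> X, \<phi>)) ` atlas M \<rparr>"

definition product_manifold :: "('a, 'i) cmfd \<Rightarrow> ('b, 'j) cmfd \<Rightarrow> ('a \<times> 'b, 'i + 'j) cmfd" where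
  "product_manifold M N =
     \<lparr> mtop = prod_topology (mtop M) (mtop N),
       midx = midx M <+> midx N,
       atlas = {(U \<times> V, \<lambda>(x, y). case_sum (\<phi> x) (\<psi> y)) | U \<phi> V \<psi>.
                  (U, \<phi>) \<in> atlas M \<and> (V, \<psi>) \<in> atlas N} \<rparr>"

definition Cn_manifold :: "(complex ^ 'n, 'n) cmfd" where
  "Cn_manifold = \<lparr> mtop = euclidean, midx = UNIV, atlas = {(UNIV, vec_nth)} \<rparr>"

section \<open>Stein manifolds\<close>

definition holo_hull :: "('a, 'i) cmfd \<Rightarrow> 'a set \<Rightarrow> 'a set" where
  "holo_hull M K = {p \<in> points M. \<forall>f\<in>holo_functions M. norm (f p) \<le> (SUP q\<in>K. norm (f q))}"

text \<open>
  The last condition says that around every point suitable global holomorphic functions form a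
  holomorphic coordinate system. (The nonemptiness of \<open>K\<close> only avoids the supremum of the empty set.)
\<close>

definition stein_manifold :: "('a, 'i) cmfd \<Rightarrow> bool" where
  "stein_manifold M \<longleftrightarrow>
     complex_manifold M \<and>
     (\<forall>K. compactin (mtop M) K \<and> K \<noteq> {} \<longrightarrow> compactin (mtop M) (holo_hull M K)) \<and>
     (\<forall>p\<in>points M. \<forall>q\<in>points M. p \<noteq> q \<longrightarrow> (\<exists>f\<in>holo_functions M. f p \<noteq> f q)) \<and>
     (\<forall>p\<in>points M. \<exists>U F. p \<in> U \<and> (\<forall>i\<in>midx M. F i \<in> holo_functions M) \<and>
        (let c = (U, \<lambda>x. \<lambda>i\<in>midx M. F i x) in
           is_chart (mtop M) (midx M) c \<and>
           (\<forall>d\<in>atlas M. holo_transition (midx M) c d \<and> holo_transition (midx M) d c)))"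

section \<open>Pseudoconvex open sets and families\<close>

definition continuous_psh_on :: "(complex ^ 'n) set \<Rightarrow> (complex ^ 'n \<Rightarrow> real) \<Rightarrow> bool" where
  "continuous_psh_on \<Omega> u \<longleftrightarrow>
     continuous_on \<Omega> u \<and>
     (\<forall>a b. (\<forall>\<zeta>. norm \<zeta> \<le> 1 \<longrightarrow> a + \<zeta> *s b \<in> \<Omega>) \<longrightarrow>
        u a \<le> 1 / (2 * pi) * integral {0..2 * pi} (\<lambda>\<theta>. u (a + cis \<theta> *s b)))"

definition pseudoconvex :: "(complex ^ 'n) set \<Rightarrow> bool" where
  "pseudoconvex \<Omega> \<longleftrightarrow>
     open \<Omega> \<and> (\<exists>u. continuous_psh_on \<Omega> u \<and> (\<forall>c. compact {z \<in> \<Omega>. u z \<le> c}))"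

definition fiber :: "('a \<times> 'b) set \<Rightarrow> 'a \<Rightarrow> 'b set" where
  "fiber X s = {x. (s, x) \<in> X}"

definition family_of_pseudoconvex_sets ::
    "('a, 'i) cmfd \<Rightarrow> ('a \<times> (complex ^ 'n)) set \<Rightarrow> bool" where
  "family_of_pseudoconvex_sets S X \<longleftrightarrow>
     openin (prod_topology (mtop S) euclidean) X \<and>
     points S \<times> {0} \<subseteq> X \<and>
     (\<forall>s\<in>points S. pseudoconvex (fiber X s))"

definition pseudoconvex_family :: "('a, 'i) cmfd \<Rightarrow> ('a \<times> (complex ^ 'n)) set \<Rightarrow> bool" where
  "pseudoconvex_family S X \<longleftrightarrow>
     family_of_pseudoconvex_sets S X \<and>
     stein_manifold (open_submanifold (product_manifold S Cn_manifold) X)"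

section \<open>Strongly convex smoothly bounded neighborhoods of the origin\<close>

fun Ck_on :: "nat \<Rightarrow> 'a::euclidean_space set \<Rightarrow> ('a \<Rightarrow> real) \<Rightarrow> bool" where
  "Ck_on 0 U f \<longleftrightarrow> continuous_on U f"
| "Ck_on (Suc k) U f \<longleftrightarrow>
     (\<forall>x\<in>U. f differentiable (at x)) \<and>
     (\<forall>v. Ck_on k U (\<lambda>x. frechet_derivative f (at x) v))"

definition Cinf_on :: "'a::euclidean_space set \<Rightarrow> ('a \<Rightarrow> real) \<Rightarrow> bool" where
  "Cinf_on U f \<longleftrightarrow> (\<forall>k. Ck_on k U f)"

definition local_defining_function ::
    "'a::euclidean_space set \<Rightarrow> 'a \<Rightarrow> 'a set \<Rightarrow> ('a \<Rightarrow> real) \<Rightarrow> bool" where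
  "local_defining_function Y p U \<rho> \<longleftrightarrow>
     open U \<and> p \<in> U \<and> Cinf_on U \<rho> \<and>
     (\<forall>x\<in>U. \<exists>v. frechet_derivative \<rho> (at x) v \<noteq> 0) \<and>
     Y \<inter> U = {x \<in> U. \<rho> x < 0}"

definition smooth_boundary :: "'a::euclidean_space set \<Rightarrow> bool" where
  "smooth_boundary Y \<longleftrightarrow> (\<forall>p\<in>frontier Y. \<exists>U \<rho>. local_defining_function Y p U \<rho>)"

text \<open>
  If \<open>\<gamma>\<close> is a curve in \<open>{\<rho> = 0}\<close> with \<open>\<gamma> 0 = p\<close> and \<open>\<gamma>' 0 = v\<close>, differentiating \<open>\<rho> \<circ> \<gamma> = 0\<close> twice gives
  \<open>\<nabla>\<rho>(p) \<bullet> \<gamma>'' 0 = - D\<^sup>2\<rho>(p)(v, v)\<close>. Hence the following is the normal curvature of the hypersurface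
  at \<open>p\<close> in the tangent direction \<open>v\<close>, with respect to the unit normal \<open>- \<nabla>\<rho> / \<bar>\<nabla>\<rho>\<bar>\<close> that points into
  \<open>{\<rho> < 0}\<close>. The operator norm of the differential is \<open>\<bar>\<nabla>\<rho>\<bar>\<close>.
\<close>

definition normal_curvature :: "('a::euclidean_space \<Rightarrow> real) \<Rightarrow> 'a \<Rightarrow> 'a \<Rightarrow> real" where
  "normal_curvature \<rho> p v =
     frechet_derivative (\<lambda>x. frechet_derivative \<rho> (at x) v) (at p) v /
     (onorm (frechet_derivative \<rho> (at p)) * (norm v)\<^sup>2)"

text \<open>
  Normal curvatures depend only on \<open>Y\<close>, so it does not matter which local defining function is used.
\<close>

definition positive_normal_curvatures :: "'a::euclidean_space set \<Rightarrow> bool" where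
  "positive_normal_curvatures Y \<longleftrightarrow>
     (\<forall>p\<in>frontier Y. \<exists>U \<rho>. local_defining_function Y p U \<rho> \<and>
        (\<forall>v. v \<noteq> 0 \<and> frechet_derivative \<rho> (at p) v = 0 \<longrightarrow> normal_curvature \<rho> p v > 0))"

definition strongly_convex :: "'a::euclidean_space set \<Rightarrow> bool" where
  "strongly_convex Y \<longleftrightarrow> convex Y \<and> positive_normal_curvatures Y"

definition strongly_convex_nbhds :: "(complex ^ 'n) set set" where
  "strongly_convex_nbhds =
     {Y. bounded Y \<and> open Y \<and> 0 \<in> Y \<and> smooth_boundary Y \<and> strongly_convex Y}"

section \<open>Hermitian ellipsoids\<close>

definition GL :: "(complex ^ 'n \<Rightarrow> complex ^ 'n) set" where
  "GL = {A. Vector_Spaces.linear (*s) (*s) A \<and> bij A}"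

definition hermitian_ellipsoids :: "(complex ^ 'n) set set" where
  "hermitian_ellipsoids = {A ` ball 0 1 | A. A \<in> GL}"

end

theory Submission
  imports Defs
begin

text \<open>
  Equivariance leaves \<open>\<Psi>\<close> little freedom on bodies with linear symmetries. Fix two coordinates \<open>i \<noteq> j\<close> and
  let \<open>Y = {F < 1}\<close> with \<open>F y = \<bar>y\<bar>\<^sup>4 + 1/4 \<bar>y\<^sub>i\<bar>\<^sup>2 \<bar>y\<^sub>j\<bar>\<^sup>2\<close>. The body \<open>Y\<close> is invariant under the change of
  sign of \<open>y\<^sub>i\<close> and under the exchange of \<open>y\<^sub>i\<close> and \<open>y\<^sub>j\<close>, so the ellipsoid \<open>\<Psi> Y\<close> meets the plane of these two
  coordinates in a round ball \<open>h (\<bar>y\<^sub>i\<bar>\<^sup>2 + \<bar>y\<^sub>j\<bar>\<^sup>2) < 1\<close> (\<open>equivariant_image_of_quartic_body\<close>).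

  Now let the fiber over \<open>s \<in> \<complex>\<close> be \<open>B\<^sub>s\<inverse> Y\<close>, where \<open>B\<^sub>s\<close> replaces \<open>x\<^sub>j\<close> by \<open>x\<^sub>j + \<mu> cnj s x\<^sub>i\<close> and multiplies
  the resulting vector by \<open>exp (\<bar>s\<bar>\<^sup>2 / 4)\<close>. By equivariance the ellipsoid over \<open>s\<close> is \<open>B\<^sub>s\<inverse> (\<Psi> Y)\<close>. The dependence
  of the shear on \<open>cnj s\<close> spoils pseudoconvexity of the total space, the dilation factor restores some
  of it, and everything rests on the fact that a round ball tolerates only \<open>\<mu>\<^sup>2 \<le> 1/2\<close> whereas \<open>Y\<close> tolerates
  slightly more. The choice below is \<open>\<mu> = 3/4\<close>, and the coefficient \<open>1/4\<close> in \<open>F\<close> is \<open>4 \<mu>\<^sup>2 - 2\<close>.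

  For \<open>Y\<close>, write \<open>z = x\<^sub>j + \<mu> cnj s x\<^sub>i\<close>. In the Fock space, where multiplication by \<open>s\<close> and differentiation
  \<open>\<partial>\<close> are adjoint, one finds
  \<open>exp (\<bar>s\<bar>\<^sup>2) (\<bar>z\<bar>\<^sup>4 + 4 \<mu>\<^sup>2 \<bar>z x\<^sub>i\<bar>\<^sup>2 + 2 \<mu>\<^sup>4 \<bar>x\<^sub>i\<bar>\<^sup>4) = (\<Sum>k. \<bar>(x\<^sub>j + \<mu> x\<^sub>i \<partial>)\<^sup>2 s\<^sup>k\<bar>\<^sup>2 / k!)\<close>,
  a sum of squares of holomorphic functions. Because \<open>2 \<mu>\<^sup>4 \<le> 1\<close>, the function \<open>F (B\<^sub>s x)\<close> exceeds the left-hand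
  side by further terms of this kind, so it is itself such a sum
  (\<open>reproducible_quartic_untwist\<close>), and the holomorphic hull of a compact set cannot leave the sublevel
  set of its maximum (\<open>stein_manifold_sublevel\<close>). Hence the total space is Stein.

  For the ellipsoids, consider the discs \<open>t \<mapsto> (t, \<lambda> (e\<^sub>j - \<mu> t e\<^sub>i))\<close>. On them the defining function of the
  ellipsoids equals
  \<open>h \<lambda>\<^sup>2 exp (r / 2) (\<mu>\<^sup>2 r + (1 - \<mu>\<^sup>2 r)\<^sup>2) = h \<lambda>\<^sup>2 (1 + (1/2 - \<mu>\<^sup>2) r + \<dots>)\<close> with \<open>r = \<bar>t\<bar>\<^sup>2\<close>. As \<open>\<mu>\<^sup>2 > 1/2\<close>, its maximum
  on small discs is attained in the center: when \<open>\<lambda>\<close> grows, the centers reach the boundary of the total space while the boundary circles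
  stay in a compact subset of it. By the maximum principle the hull of that compact set is not
  compact (\<open>not_stein_ellipsoid_family\<close>). Here one needs that holomorphic functions, which are only given to be
  continuous and holomorphic in each variable, are holomorphic along complex lines
  (\<open>separately_holomorphic_imp_holomorphic_on_line\<close>).
\<close>

(* The dollar sign is reserved for components of vectors. *)
no_notation fps_nth (infixl "$" 75)

section \<open>Holomorphy along complex lines\<close>

text \<open>
  Exchanging the two integrations reduces this to the theorem of Cauchy for each parameter value. It is the
  hypothesis of the theorem of Morera for functions defined by a contour integral.
\<close>

lemma triangle_integral_of_parametric_integral_eq_0:
  fixes F :: "complex \<Rightarrow> complex \<Rightarrow> complex"
  assumes cont: "continuous_on ((convex hull {a, b, c}) \<times> path_image \<gamma>) (\<lambda>(z, w). F z w)"
    and hol: "\<And>w. w \<in> path_image \<gamma> \<Longrightarrow> (\<lambda>z. F z w) holomorphic_on convex hull {a, b, c}"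
    and \<gamma>: "valid_path \<gamma>" "continuous_on {0..1} (\<lambda>t. vector_derivative \<gamma> (at t))"
  shows "contour_integral (linepath a b) (\<lambda>z. contour_integral \<gamma> (F z)) +
         contour_integral (linepath b c) (\<lambda>z. contour_integral \<gamma> (F z)) +
         contour_integral (linepath c a) (\<lambda>z. contour_integral \<gamma> (F z)) = 0"
proof -
  let ?T = "convex hull {a, b, c}"
  have swap: "contour_integral (linepath p q) (\<lambda>z. contour_integral \<gamma> (F z)) =
      contour_integral \<gamma> (\<lambda>w. contour_integral (linepath p q) (\<lambda>z. F z w))"
    and int: "(\<lambda>w. contour_integral (linepath p q) (\<lambda>z. F z w)) contour_integrable_on \<gamma>"
    if pq: "closed_segment p q \<subseteq> ?T" for p q
  proof -
    have c: "continuous_on (closed_segment p q \<times> path_image \<gamma>) (\<lambda>(z, w). F z w)"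
      using cont by (rule continuous_on_subset) (intro Sigma_mono pq order_refl)
    show "contour_integral (linepath p q) (\<lambda>z. contour_integral \<gamma> (F z)) =
      contour_integral \<gamma> (\<lambda>w. contour_integral (linepath p q) (\<lambda>z. F z w))"
      by (rule contour_integral_swap) (use c \<gamma> in auto)
    have "continuous_on ({0..1} \<times> cbox 0 (1::real)) ((\<lambda>(z, w). F z w) \<circ> (\<lambda>(t, u). (linepath p q u, \<gamma> t)))"
    proof (rule continuous_on_compose)
      have "continuous_on {0..1} \<gamma>"
        using \<gamma>(1) valid_path_imp_path path_def by blast
      then have "continuous_on ({0..1} \<times> cbox 0 (1::real)) (\<lambda>tu. \<gamma> (fst tu))"
        by (rule continuous_on_compose2) (auto intro: continuous_intros)
      then show "continuous_on ({0..1} \<times> cbox 0 (1::real)) (\<lambda>(t, u). (linepath p q u, \<gamma> t))"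
        by (auto simp: case_prod_unfold linepath_def intro!: continuous_intros)
      show "continuous_on ((\<lambda>(t, u). (linepath p q u, \<gamma> t)) ` ({0..1} \<times> cbox 0 (1::real))) (\<lambda>(z, w). F z w)"
        by (rule continuous_on_subset[OF c]) (auto simp: path_image_def linepath_in_path)
    qed
    then have "continuous_on ({0..1} \<times> cbox 0 1) (\<lambda>(t, u). F (linepath p q u) (\<gamma> t) * (q - p))"
      by (auto simp: case_prod_unfold o_def intro!: continuous_intros)
    then have "continuous_on {0..1} (\<lambda>t. integral (cbox 0 1) (\<lambda>u. F (linepath p q u) (\<gamma> t) * (q - p)))"
      by (rule integral_continuous_on_param)
    then have "continuous_on {0..1} (\<lambda>t. contour_integral (linepath p q) (\<lambda>z. F z (\<gamma> t)))"
      by (simp add: contour_integral_integral)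
    then show "(\<lambda>w. contour_integral (linepath p q) (\<lambda>z. F z w)) contour_integrable_on \<gamma>"
      unfolding contour_integrable_on
      by (intro integrable_continuous_real continuous_intros \<gamma>(2))
  qed
  have seg: "closed_segment a b \<subseteq> ?T" "closed_segment b c \<subseteq> ?T" "closed_segment c a \<subseteq> ?T"
    using segments_subset_convex_hull by blast+
  have ab: "(\<lambda>z. F z w) contour_integrable_on linepath p q" if "w \<in> path_image \<gamma>" "closed_segment p q \<subseteq> ?T" for w p q
    by (rule contour_integrable_continuous_linepath)
      (rule continuous_on_subset[OF holomorphic_on_imp_continuous_on[OF hol[OF that(1)]] that(2)])
  have "contour_integral (linepath a b) (\<lambda>z. F z w) + contour_integral (linepath b c) (\<lambda>z. F z w)
      + contour_integral (linepath c a) (\<lambda>z. F z w) = 0" if w: "w \<in> path_image \<gamma>" for w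
    using contour_integral_unique[OF Cauchy_theorem_triangle[OF hol[OF w]]] ab[OF w] seg
    by (auto simp: add_ac)
  then show ?thesis
    by (simp add: swap int seg contour_integral_add[symmetric] contour_integrable_add contour_integral_eq_0)
qed

text \<open>
  A weak form of the lemma of Osgood. Near a point of the line, the Cauchy formula in the second
  variable over a fixed circle writes \<open>g (t, c t)\<close> as a contour integral of functions that are holomorphic in \<open>t\<close>,
  so that the theorem of Morera applies.
\<close>

lemma separately_holomorphic_imp_holomorphic_on_line:
  fixes g :: "complex \<times> complex \<Rightarrow> complex" and c :: complex
  assumes W: "open W" and cont: "continuous_on W g"
    and fst: "\<And>z w. (z, w) \<in> W \<Longrightarrow> (\<lambda>t. g (t, w)) field_differentiable at z"
    and snd: "\<And>z w. (z, w) \<in> W \<Longrightarrow> (\<lambda>t. g (z, t)) field_differentiable at w"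
  shows "(\<lambda>t. g (t, c * t)) holomorphic_on {t. (t, c * t) \<in> W}"
proof -
  have oW: "open {t. (t, c * t) \<in> W}"
    using open_vimage[OF W continuous_on_Pair[OF continuous_on_id continuous_on_mult_left[OF continuous_on_id]]]
    by (simp add: vimage_def)
  have "(\<lambda>t. g (t, c * t)) field_differentiable at p" if p: "(p, c * p) \<in> W" for p
  proof -
    from open_prod_elim[OF W p] obtain U V where UV: "open U" "open V" "p \<in> U" "c * p \<in> V" "U \<times> V \<subseteq> W"
      by (metis mem_Sigma_iff)
    obtain e where e: "e > 0" "cball (c * p) e \<subseteq> V"
      using UV open_contains_cball by metis
    define B where "B = U \<inter> {t. c * t \<in> ball (c * p) e}"
    have "open B" unfolding B_def
      using open_Int[OF UV(1) open_vimage[OF open_ball continuous_on_mult_left[OF continuous_on_id]]]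
      by (simp add: vimage_def)
    moreover have "p \<in> B" using UV e by (auto simp: B_def)
    ultimately obtain d where d: "d > 0" "ball p d \<subseteq> B" by (meson openE)
    let ?\<gamma> = "circlepath (c * p) e"
    let ?F = "\<lambda>z w. g (z, w) / (w - c * z)"
    have inW: "(z, w) \<in> W" if "z \<in> ball p d" "w \<in> cball (c * p) e" for z w
      using that d e UV by (auto simp: B_def subset_iff)
    have near: "norm (c * z - c * p) < e" if "z \<in> ball p d" for z
      using that d by (auto simp: B_def dist_norm norm_minus_commute subset_iff)
    have ne: "w \<noteq> c * z" if "z \<in> ball p d" "w \<in> path_image ?\<gamma>" for z w
      using near[OF that(1)] that(2) e by (auto simp: dist_norm norm_minus_commute)
    have Cauchy: "g (z, c * z) = contour_integral ?\<gamma> (?F z) / (2 * of_real pi * \<i>)" if z: "z \<in> ball p d" for z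
    proof -
      have "(\<lambda>w. g (z, w)) holomorphic_on cball (c * p) e"
        unfolding holomorphic_on_def
        using snd inW[OF z] field_differentiable_at_within by blast
      from contour_integral_unique[OF Cauchy_integral_circlepath_simple[OF this near[OF z]]]
      show ?thesis by simp
    qed
    have contF: "continuous_on (ball p d \<times> path_image ?\<gamma>) (\<lambda>(z, w). ?F z w)"
    proof -
      have "continuous_on (ball p d \<times> path_image ?\<gamma>) g"
        by (rule continuous_on_subset[OF cont]) (use inW e(1) in auto)
      moreover have ne': "snd q - c * fst q \<noteq> 0" if "q \<in> ball p d \<times> path_image ?\<gamma>" for q
        using ne[of "fst q" "snd q"] that unfolding mem_Times_iff by simp
      ultimately show ?thesis
        unfolding case_prod_unfold prod.collapse
        by (intro continuous_on_divide continuous_intros ballI) (blast intro: ne')+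
    qed
    have holF: "(\<lambda>z. ?F z w) holomorphic_on ball p d" if w: "w \<in> path_image ?\<gamma>" for w
    proof -
      have "(\<lambda>z. g (z, w)) holomorphic_on ball p d"
        unfolding holomorphic_on_def
        by (rule ballI, rule field_differentiable_at_within, rule fst, rule inW) (use w e(1) in auto)
      then show ?thesis
        by (intro holomorphic_on_divide holomorphic_intros) (use ne[OF _ w] in simp_all)
    qed
    have contG: "continuous_on (ball p d) (\<lambda>t. g (t, c * t))"
    proof (rule continuous_on_compose2[OF cont])
      show "(\<lambda>t. (t, c * t)) ` ball p d \<subseteq> W"
        using inW near by (auto simp: dist_norm norm_minus_commute less_imp_le)
    qed (intro continuous_intros)
    have "(\<lambda>t. g (t, c * t)) analytic_on ball p d"
    proof (rule Morera_triangle[OF contG open_ball], intro allI impI)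
      fix x y z assume sub: "convex hull {x, y, z} \<subseteq> ball p d"
      have eq: "contour_integral (linepath a b) (\<lambda>t. g (t, c * t)) =
          contour_integral (linepath a b) (\<lambda>t. contour_integral ?\<gamma> (?F t)) / (2 * of_real pi * \<i>)"
        if "closed_segment a b \<subseteq> ball p d" for a b
      proof -
        have "contour_integral (linepath a b) (\<lambda>t. contour_integral ?\<gamma> (?F t)) =
            contour_integral (linepath a b) (\<lambda>t. (2 * of_real pi * \<i>) * g (t, c * t))"
          by (rule contour_integral_eq) (use that Cauchy in \<open>auto simp: subset_iff\<close>)
        also have "\<dots> = (2 * of_real pi * \<i>) * contour_integral (linepath a b) (\<lambda>t. g (t, c * t))"
          by (rule contour_integral_lmul, rule contour_integrable_continuous_linepath)
            (use contG that continuous_on_subset in blast)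
        finally show ?thesis by simp
      qed
      have seg: "closed_segment x y \<subseteq> ball p d" "closed_segment y z \<subseteq> ball p d" "closed_segment z x \<subseteq> ball p d"
        using segments_subset_convex_hull(1,3,5)[THEN subset_trans, OF sub] by blast+
      have "contour_integral (linepath x y) (\<lambda>t. contour_integral ?\<gamma> (?F t)) +
         contour_integral (linepath y z) (\<lambda>t. contour_integral ?\<gamma> (?F t)) +
         contour_integral (linepath z x) (\<lambda>t. contour_integral ?\<gamma> (?F t)) = 0"
      proof (rule triangle_integral_of_parametric_integral_eq_0)
        show "continuous_on ((convex hull {x, y, z}) \<times> path_image ?\<gamma>) (\<lambda>(z, w). ?F z w)"
          by (rule continuous_on_subset[OF contF]) (use sub in auto)
        show "\<And>w. w \<in> path_image ?\<gamma> \<Longrightarrow> (\<lambda>z. ?F z w) holomorphic_on convex hull {x, y, z}"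
          using holF sub holomorphic_on_subset by blast
        show "continuous_on {0..1} (\<lambda>t. vector_derivative ?\<gamma> (at t))"
          by (auto simp: vector_derivative_circlepath intro!: continuous_intros)
      qed auto
      then show "contour_integral (linepath x y) (\<lambda>t. g (t, c * t)) +
          contour_integral (linepath y z) (\<lambda>t. g (t, c * t)) + contour_integral (linepath z x) (\<lambda>t. g (t, c * t)) = 0"
        by (simp add: eq seg add_divide_distrib[symmetric])
    qed
    then show ?thesis
      using d(1) analytic_on_imp_differentiable_at by (metis centre_in_ball)
  qed
  then show ?thesis
    using oW by (simp add: holomorphic_on_open field_differentiable_def)
qed

section \<open>Manifolds spread over open subsets of \<open>\<complex> \<times> \<complex>\<^sup>n\<close>\<close>

definition complex_line :: "(nat \<Rightarrow> complex, nat) cmfd" where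
  "complex_line = \<lparr> mtop = cspace {0}, midx = {0}, atlas = {(topspace (cspace {0}), id)} \<rparr>"

lemma topspace_cspace: "topspace (cspace I) = extensional I"
  by (auto simp: cspace_def PiE_def)

lemma continuous_map_into_cspace:
  "continuous_map X (cspace I) f \<longleftrightarrow>
     f \<in> topspace X \<rightarrow> extensional I \<and> (\<forall>i\<in>I. continuous_map X euclidean (\<lambda>x. f x i))"
  by (auto simp: cspace_def continuous_map_componentwise Pi_iff)

lemma continuous_map_cspace_component:
  "i \<in> I \<Longrightarrow> continuous_map (cspace I) euclidean (\<lambda>z. z i)"
  unfolding cspace_def by (rule continuous_map_product_projection)

text \<open>
  The base of all families will be the complex line. Its points are functions on \<open>{0}\<close>, extended by
  \<^const>\<open>undefined\<close>; replacing such a function by its value identifies the total spaces with open subsets \<open>W\<close> of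
  the normed space \<open>\<complex> \<times> \<complex>\<^sup>n\<close>, on which compactness and continuity have their usual meaning.
\<close>

definition to_model :: "(nat \<Rightarrow> complex) \<times> (complex ^ 'n) \<Rightarrow> complex \<times> (complex ^ 'n)" where
  "to_model p = (fst p 0, snd p)"

definition of_model :: "complex \<times> (complex ^ 'n) \<Rightarrow> (nat \<Rightarrow> complex) \<times> (complex ^ 'n)" where
  "of_model q = ((\<lambda>k\<in>{0}. fst q), snd q)"

lemma to_model_of_model [simp]: "to_model (of_model q) = q"
  by (simp add: to_model_def of_model_def)

lemma extensional_of_model [simp]: "fst (of_model q) \<in> extensional {0}"
  by (simp add: of_model_def)

lemma extensional_0_eq: "s \<in> extensional {0::nat} \<Longrightarrow> (\<lambda>k\<in>{0}. s 0) = s"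
  by (rule extensionalityI) auto

lemma of_model_to_model: "fst p \<in> extensional {0} \<Longrightarrow> of_model (to_model p) = p"
  by (simp add: to_model_def of_model_def extensional_0_eq prod_eq_iff)

lemma homeomorphic_maps_model:
  "homeomorphic_maps (prod_topology (cspace {0}) euclidean) euclidean to_model of_model"
proof -
  have 1: "continuous_map (prod_topology (cspace {0}) euclidean) (prod_topology euclidean euclidean)
      (to_model :: _ \<Rightarrow> complex \<times> (complex ^ 'n))"
    unfolding to_model_def continuous_map_pairwise o_def
    using continuous_map_compose[OF continuous_map_fst continuous_map_cspace_component[of 0 "{0}"]]
    by (auto simp: o_def continuous_map_snd)
  have 2: "continuous_map (prod_topology euclidean euclidean) (prod_topology (cspace {0}) euclidean)
      (of_model :: complex \<times> (complex ^ 'n) \<Rightarrow> _)"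
    unfolding of_model_def continuous_map_pairwise o_def
    using continuous_map_fst[of "euclidean :: complex topology" "euclidean :: (complex ^ 'n) topology"]
      continuous_map_snd[of "euclidean :: complex topology" "euclidean :: (complex ^ 'n) topology"]
    by (auto simp: continuous_map_into_cspace)
  show ?thesis
    unfolding homeomorphic_maps_def using 1 2 unfolding prod_topology_euclidean
    by (auto simp: topspace_cspace of_model_to_model)
qed

definition coordinates :: "(nat \<Rightarrow> complex) \<times> (complex ^ 'n) \<Rightarrow> nat + 'n \<Rightarrow> complex" where
  "coordinates = (\<lambda>(s, x). case_sum s (vec_nth x))"

definition point_at :: "(nat + 'n \<Rightarrow> complex) \<Rightarrow> complex \<times> (complex ^ 'n)" where
  "point_at z = (z (Inl 0), \<chi> k. z (Inr k))"

lemma point_at_coordinates [simp]: "point_at (coordinates p) = to_model p"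
  by (simp add: point_at_def coordinates_def to_model_def case_prod_unfold vec_eq_iff)

lemma extensional_coordinates:
  "fst p \<in> extensional {0} \<Longrightarrow> coordinates p \<in> extensional ({0} <+> UNIV)"
  by (auto simp: coordinates_def case_prod_unfold extensional_def split: sum.split)

lemma coordinates_point_at:
  assumes "z \<in> extensional ({0} <+> UNIV)"
  shows "coordinates (of_model (point_at z)) = z"
proof
  fix i
  have "undefined = z (Inl k)" if "k \<noteq> 0" for k
    by (rule extensional_arb[OF assms, symmetric]) (use that in auto)
  then show "coordinates (of_model (point_at z)) i = z i"
    by (cases i) (auto simp: coordinates_def of_model_def point_at_def restrict_def)
qed

lemma continuous_map_vec:
  fixes f :: "'a \<Rightarrow> complex ^ 'n"
  assumes "\<And>k. continuous_map X euclidean (\<lambda>x. f x $ k)"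
  shows "continuous_map X euclidean f"
  unfolding continuous_map_atin
proof
  fix a assume "a \<in> topspace X"
  then show "limitin euclidean f (f a) (atin X a)"
    using assms by (auto simp: continuous_map_atin intro!: vec_tendstoI)
qed

lemma homeomorphic_maps_coordinates:
  "homeomorphic_maps (prod_topology (cspace {0}) euclidean) (cspace ({0} <+> (UNIV :: 'n::finite set)))
     coordinates (of_model \<circ> point_at)"
proof -
  have "continuous_map (prod_topology (cspace {0}) euclidean) (cspace ({0} <+> (UNIV :: 'n::finite set))) coordinates"
    unfolding continuous_map_into_cspace
  proof (intro conjI ballI)
    fix i :: "nat + 'n" assume i: "i \<in> {0} <+> UNIV"
    show "continuous_map (prod_topology (cspace {0}) euclidean) euclidean
           (\<lambda>p. coordinates (p :: (nat \<Rightarrow> complex) \<times> (complex ^ 'n)) i)"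
    proof (cases i)
      case (Inl k)
      then have "k = 0" using i by auto
      then show ?thesis
        using Inl continuous_map_compose[OF continuous_map_fst continuous_map_cspace_component[of 0 "{0}"]]
        by (auto simp: coordinates_def case_prod_unfold o_def)
    next
      case (Inr k)
      have "continuous_map euclidean euclidean (\<lambda>x::complex^'n. x $ k)"
        by (auto simp: continuous_map_iff_continuous2 intro: continuous_intros)
      from continuous_map_compose[OF continuous_map_snd this] show ?thesis
        using Inr by (auto simp: coordinates_def case_prod_unfold o_def)
    qed
  qed (auto simp: topspace_cspace intro!: extensional_coordinates)
  moreover have "continuous_map (cspace ({0} <+> (UNIV :: 'n set))) (prod_topology (cspace {0}) euclidean)
      (of_model \<circ> point_at)"
    unfolding continuous_map_pairwise
  proof
    have "continuous_map (cspace ({0} <+> (UNIV :: 'n set))) euclidean (\<lambda>z. z (Inl 0))"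
      by (rule continuous_map_cspace_component) auto
    then show "continuous_map (cspace ({0} <+> (UNIV :: 'n set))) (cspace {0}) (fst \<circ> (of_model \<circ> point_at))"
      by (auto simp: continuous_map_into_cspace o_def of_model_def point_at_def)
    show "continuous_map (cspace ({0} <+> (UNIV :: 'n set))) euclidean (snd \<circ> (of_model \<circ> point_at))"
      by (rule continuous_map_vec)
        (auto simp: o_def of_model_def point_at_def intro!: continuous_map_cspace_component)
  qed
  ultimately show ?thesis
    unfolding homeomorphic_maps_def
    by (auto simp: topspace_cspace of_model_to_model coordinates_point_at)
qed

lemma open_slice:
  assumes D: "openin (cspace I) D" and z: "z \<in> D" "i \<in> I"
  shows "open {w. z(i := w) \<in> D}"
proof -
  have "z \<in> extensional I"
    using openin_subset[OF D] z by (auto simp: topspace_cspace)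
  then have "continuous_map euclidean (cspace I) (\<lambda>w. z(i := w))"
    using z by (auto simp: continuous_map_into_cspace extensional_def)
  from openin_continuous_map_preimage[OF this D] show ?thesis by simp
qed

text \<open>
  Holomorphy is formulated with functions that are defined everywhere, so that changing \<open>f\<close> outside \<open>D\<close> could affect the
  difference quotients. It does not, since \<open>D\<close> is open along each coordinate line.
\<close>

lemma holo_on_cong:
  assumes "holo_on I D f" and eq: "\<And>z. z \<in> D \<Longrightarrow> f z = g z"
  shows "holo_on I D g"
proof -
  have D: "openin (cspace I) D" using assms by (simp add: holo_on_def)
  have "(\<lambda>w. g (z(i := w))) field_differentiable at (z i)" if z: "z \<in> D" "i \<in> I" for z i
  proof -
    obtain d where "((\<lambda>w. f (z(i := w))) has_field_derivative d) (at (z i))"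
      using assms(1) z unfolding holo_on_def field_differentiable_def by blast
    then have "((\<lambda>w. g (z(i := w))) has_field_derivative d) (at (z i))"
      by (rule has_field_derivative_transform_within_open[OF _ open_slice[OF D z]]) (use z eq in auto)
    then show ?thesis
      by (auto simp: field_differentiable_def)
  qed
  moreover have "continuous_map (subtopology (cspace I) D) euclidean g"
    by (rule continuous_map_eq[of _ _ f]) (use assms in \<open>auto simp: holo_on_def\<close>)
  ultimately show ?thesis using D by (simp add: holo_on_def)
qed

lemma holo_on_coordinate:
  fixes i :: 'i
  assumes "openin (cspace I) D" "i \<in> I"
  shows "holo_on I D (\<lambda>z. z i)"
proof -
  have "(\<lambda>w. (z(k := w)) i) field_differentiable at (z k)" for z :: "'i \<Rightarrow> complex" and k
    by (cases "i = k") auto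
  then show ?thesis
    using assms by (auto simp: holo_on_def continuous_map_from_subtopology continuous_map_cspace_component)
qed

lemma holo_transition_same_chart:
  assumes U: "is_chart T I (U, \<phi>)" and eq: "\<And>x i. x \<in> U \<Longrightarrow> i \<in> I \<Longrightarrow> \<psi> x i = \<phi> x i"
  shows "holo_transition I (U, \<phi>) (U, \<psi>)"
proof -
  have "openin (cspace I) (\<phi> ` U)" using U by (simp add: is_chart_def)
  moreover have "z i = \<psi> (inv_into U \<phi> z) i" if "z \<in> \<phi> ` U" "i \<in> I" for z i
    using eq[OF inv_into_into[OF that(1)] that(2)] f_inv_into_f[OF that(1)] by simp
  ultimately have "holo_on I (\<phi> ` U) (\<lambda>z. \<psi> (inv_into U \<phi> z) i)" if "i \<in> I" for i
    using that by (intro holo_on_cong[OF holo_on_coordinate[OF _ that]])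
  then show ?thesis
    by (simp add: holo_transition_def)
qed

lemma complex_manifold_single_chart:
  assumes "finite I" "Hausdorff_space T" "second_countable T"
    and chart: "is_chart T I (topspace T, \<phi>)"
  shows "complex_manifold \<lparr> mtop = T, midx = I, atlas = {(topspace T, \<phi>)} \<rparr>"
  using assms holo_transition_same_chart[OF chart] by (simp add: complex_manifold_def)

lemma second_countable_euclidean:
  "second_countable (euclidean :: 'a::second_countable_topology topology)"
proof -
  obtain B :: "'a set set" where "countable B" "topological_basis B"
    using ex_countable_basis by blast
  moreover have "\<exists>V\<in>B. x \<in> V \<and> V \<subseteq> U" if "open U" "x \<in> U" for U x
    by (rule topological_basisE[OF \<open>topological_basis B\<close> that]) blast
  ultimately show ?thesis
    unfolding second_countable_def
    by (intro exI[of _ B]) (simp add: topological_basis_open)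
qed

lemma complex_manifold_complex_line: "complex_manifold complex_line"
proof -
  have "homeomorphic_maps (cspace {0::nat}) euclidean (\<lambda>s. s 0) (\<lambda>z. \<lambda>k\<in>{0}. z)"
    unfolding homeomorphic_maps_def
    by (auto simp: continuous_map_into_cspace continuous_map_cspace_component topspace_cspace extensional_0_eq)
  then have "cspace {0::nat} homeomorphic_space (euclidean :: complex topology)"
    using homeomorphic_space_def by blast
  then have "Hausdorff_space (cspace {0::nat})" "second_countable (cspace {0::nat})"
    using homeomorphic_Hausdorff_space[of "cspace {0::nat}" "euclidean :: complex topology"]
      homeomorphic_space_second_countability[of "cspace {0::nat}" "euclidean :: complex topology"]
    by (simp_all add: second_countable_euclidean)
  moreover have "is_chart (cspace {0::nat}) {0} (topspace (cspace {0}), id)"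
    by (simp add: is_chart_def)
  ultimately show ?thesis
    unfolding complex_line_def by (intro complex_manifold_single_chart) auto
qed

definition over :: "(complex \<times> (complex ^ 'n)) set \<Rightarrow> ((nat \<Rightarrow> complex) \<times> (complex ^ 'n)) set" where
  "over W = {p. fst p \<in> extensional {0} \<and> to_model p \<in> W}"

definition mfd_over :: "(complex \<times> (complex ^ 'n)) set \<Rightarrow> ((nat \<Rightarrow> complex) \<times> (complex ^ 'n), nat + 'n) cmfd" where
  "mfd_over W = open_submanifold (product_manifold complex_line Cn_manifold) (over W)"

abbreviation ambient :: "((nat \<Rightarrow> complex) \<times> (complex ^ 'n)) topology" where
  "ambient \<equiv> prod_topology (cspace {0}) euclidean"

lemma mfd_over_eq:
  "mfd_over W = \<lparr> mtop = subtopology ambient (over W), midx = {0} <+> UNIV, atlas = {(over W, coordinates)} \<rparr>"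
proof -
  have "topspace (cspace {0}) \<times> UNIV \<inter> over W = over W"
    by (auto simp: over_def topspace_cspace)
  then show ?thesis
    by (simp add: mfd_over_def open_submanifold_def product_manifold_def complex_line_def Cn_manifold_def coordinates_def)
qed

lemma openin_over:
  assumes "open W"
  shows "openin ambient (over W)"
proof -
  have "over W = {p \<in> topspace ambient. to_model p \<in> W}"
    by (auto simp: over_def topspace_cspace)
  moreover have "continuous_map ambient euclidean (to_model :: _ \<Rightarrow> complex \<times> (complex ^ 'n))"
    using homeomorphic_maps_model by (auto simp: homeomorphic_maps_def)
  ultimately show ?thesis
    using openin_continuous_map_preimage[of ambient euclidean to_model W] assms by auto
qed

lemma topspace_over: "topspace (subtopology ambient (over W)) = over W"
  by (auto simp: over_def topspace_cspace)

lemma to_model_over: "to_model ` over W = W"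
proof -
  have "q \<in> to_model ` over W" if "q \<in> W" for q
    by (rule image_eqI[of _ _ "of_model q"]) (use that in \<open>auto simp: over_def\<close>)
  then show ?thesis by (auto simp: over_def)
qed

lemma homeomorphic_maps_over:
  "homeomorphic_maps (subtopology ambient (over W)) (subtopology euclidean W) to_model of_model"
proof (rule homeomorphic_maps_subtopologies[OF homeomorphic_maps_model])
  show "to_model ` (topspace ambient \<inter> over W) = topspace euclidean \<inter> W"
    using to_model_over[of W] topspace_over[of W] by simp
qed

lemma is_chart_coordinates:
  fixes W :: "(complex \<times> (complex ^ 'n)) set"
  assumes "open W"
  shows "is_chart (subtopology ambient (over W)) ({0} <+> UNIV) (over W, coordinates)"
proof -
  let ?J = "{0} <+> (UNIV :: 'n set)"
  have h: "homeomorphic_map ambient (cspace ?J) coordinates"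
    using homeomorphic_maps_coordinates homeomorphic_map_maps by blast
  have o: "openin (cspace ?J) (coordinates ` over W)"
    using homeomorphic_imp_open_map[OF h] openin_over[OF assms] by (auto simp: open_map_def)
  have "homeomorphic_map (subtopology ambient (over W)) (subtopology (cspace ?J) (coordinates ` over W)) coordinates"
    using openin_subset[OF o] openin_subset[OF openin_over[OF assms]]
    by (intro homeomorphic_map_subtopologies[OF h]) (simp add: inf.absorb2)
  moreover have "openin (subtopology ambient (over W)) (over W)"
    using openin_topspace[of "subtopology ambient (over W)"] unfolding topspace_over .
  ultimately show ?thesis
    using o by (simp add: is_chart_def subtopology_subtopology)
qed

lemma complex_manifold_mfd_over:
  fixes W :: "(complex \<times> (complex ^ 'n)) set"
  assumes "open W"
  shows "complex_manifold (mfd_over W)"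
proof -
  have hs: "subtopology ambient (over W) homeomorphic_space subtopology euclidean W"
    using homeomorphic_maps_over homeomorphic_space_def by blast
  have "Hausdorff_space (subtopology ambient (over W))" "second_countable (subtopology ambient (over W))"
    using homeomorphic_Hausdorff_space[OF hs] homeomorphic_space_second_countability[OF hs]
    by (auto intro!: second_countable_subtopology second_countable_euclidean Hausdorff_space_subtopology)
  moreover have "finite ({0} <+> (UNIV :: 'n set))" by simp
  ultimately show ?thesis
    unfolding mfd_over_eq
    using complex_manifold_single_chart[where \<phi> = coordinates and T = "subtopology ambient (over W)", unfolded topspace_over]
      is_chart_coordinates[OF assms] by blast
qed

definition vec_upd :: "complex ^ 'n \<Rightarrow> 'n \<Rightarrow> complex \<Rightarrow> complex ^ 'n" where
  "vec_upd x k t = (\<chi> l. if l = k then t else x $ l)"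

text \<open>
  This is what \<^const>\<open>holo_on\<close> becomes after the identification with \<open>\<complex> \<times> \<complex>\<^sup>n\<close>.
\<close>

definition separately_holomorphic_on :: "(complex \<times> (complex ^ 'n)) set \<Rightarrow> (complex \<times> (complex ^ 'n) \<Rightarrow> complex) \<Rightarrow> bool" where
  "separately_holomorphic_on W g \<longleftrightarrow>
     continuous_on W g \<and>
     (\<forall>(s, x)\<in>W. (\<lambda>t. g (t, x)) field_differentiable at s \<and>
        (\<forall>k. (\<lambda>t. g (s, vec_upd x k t)) field_differentiable at (x $ k)))"

lemma inv_into_coordinates:
  assumes "z \<in> coordinates ` over W"
  shows "inv_into (over W) coordinates z = of_model (point_at z)"
proof -
  obtain p where p: "p \<in> over W" "z = coordinates p" using assms by auto
  have "inj_on coordinates (over W)"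
    by (rule inj_on_inverseI[of _ "of_model \<circ> point_at"]) (auto simp: over_def of_model_to_model)
  then show ?thesis
    using p by (auto simp: over_def of_model_to_model)
qed

lemma holo_functions_mfd_over:
  fixes W :: "(complex \<times> (complex ^ 'n)) set"
  assumes "open W"
  shows "f \<in> holo_functions (mfd_over W) \<longleftrightarrow> separately_holomorphic_on W (f \<circ> of_model)"
proof -
  let ?J = "{0} <+> (UNIV :: 'n set)" and ?D = "coordinates ` over W" and ?g = "f \<circ> of_model"
  have chart: "is_chart (subtopology ambient (over W)) ?J (over W, coordinates)"
    by (rule is_chart_coordinates[OF assms])
  then have D: "openin (cspace ?J) ?D" by (simp add: is_chart_def)
  have in_D: "z \<in> ?D \<longleftrightarrow> z \<in> extensional ?J \<and> point_at z \<in> W" for z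
  proof
    assume "z \<in> extensional ?J \<and> point_at z \<in> W"
    then show "z \<in> ?D"
      by (intro image_eqI[of _ _ "of_model (point_at z)"])
        (auto simp: coordinates_point_at over_def)
  qed (auto simp: over_def extensional_coordinates)
  have cong: "f (inv_into (over W) coordinates z) = ?g (point_at z)" if "z \<in> ?D" for z
    using that by (simp add: inv_into_coordinates)
  have "f \<in> holo_functions (mfd_over W) \<longleftrightarrow> holo_on ?J ?D (\<lambda>z. f (inv_into (over W) coordinates z))"
    by (simp add: holo_functions_def mfd_over_eq)
  also have "\<dots> \<longleftrightarrow> holo_on ?J ?D (\<lambda>z. ?g (point_at z))"
    by (intro iffI; erule holo_on_cong) (simp_all only: cong)
  also have "\<dots> \<longleftrightarrow> separately_holomorphic_on W ?g"
  proof -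
    have hom: "homeomorphic_maps (subtopology (cspace ?J) ?D) (subtopology euclidean W) point_at (coordinates \<circ> of_model)"
    proof -
      have "homeomorphic_maps (cspace ?J) (euclidean :: (complex \<times> (complex ^ 'n)) topology)
          (to_model \<circ> (of_model \<circ> point_at)) (coordinates \<circ> of_model)"
        by (rule homeomorphic_maps_compose)
          (use homeomorphic_maps_sym homeomorphic_maps_coordinates homeomorphic_maps_model in blast)
      then have h: "homeomorphic_maps (cspace ?J) (euclidean :: (complex \<times> (complex ^ 'n)) topology) point_at (coordinates \<circ> of_model)"
        by (simp add: o_def)
      show ?thesis
      proof (rule homeomorphic_maps_subtopologies_alt[OF h])
        show "(coordinates \<circ> of_model) ` (topspace euclidean \<inter> W) \<subseteq> ?D"
          by (auto simp: over_def)
        show "point_at ` (topspace (cspace ?J) \<inter> ?D) \<subseteq> W"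
          using in_D by blast
      qed
    qed
    have "continuous_map (subtopology (cspace ?J) ?D) euclidean (\<lambda>z. ?g (point_at z)) \<longleftrightarrow> continuous_on W ?g"
    proof
      assume "continuous_map (subtopology (cspace ?J) ?D) euclidean (\<lambda>z. ?g (point_at z))"
      moreover have "continuous_map (subtopology euclidean W) (subtopology (cspace ?J) ?D) (coordinates \<circ> of_model)"
        using hom by (simp add: homeomorphic_maps_def)
      ultimately have "continuous_map (subtopology euclidean W) euclidean ((\<lambda>z. ?g (point_at z)) \<circ> (coordinates \<circ> of_model))"
        by (rule continuous_map_compose[rotated])
      then show "continuous_on W ?g"
        by (simp add: o_def continuous_map_iff_continuous)
    next
      assume "continuous_on W ?g"
      then have "continuous_map (subtopology euclidean W) euclidean ?g"
        by (simp add: continuous_map_iff_continuous)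
      moreover have "continuous_map (subtopology (cspace ?J) ?D) (subtopology euclidean W) point_at"
        using hom by (simp add: homeomorphic_maps_def)
      ultimately show "continuous_map (subtopology (cspace ?J) ?D) euclidean (\<lambda>z. ?g (point_at z))"
        using continuous_map_compose[of _ _ point_at euclidean ?g] by (simp add: o_def)
    qed
    moreover have "(\<forall>z\<in>?D. \<forall>i\<in>?J. (\<lambda>w. ?g (point_at (z(i := w)))) field_differentiable at (z i)) \<longleftrightarrow>
      (\<forall>(s, x)\<in>W. (\<lambda>t. ?g (t, x)) field_differentiable at s \<and>
        (\<forall>k. (\<lambda>t. ?g (s, vec_upd x k t)) field_differentiable at (x $ k)))" (is "?L = ?R")
    proof -
      have 1: "point_at (z(Inl 0 := w)) = (w, snd (point_at z))" for z :: "nat + 'n \<Rightarrow> complex" and w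
        by (simp add: point_at_def)
      have 2: "point_at (z(Inr k := w)) = (fst (point_at z), vec_upd (snd (point_at z)) k w)" for z :: "nat + 'n \<Rightarrow> complex" and w k
        by (simp add: point_at_def vec_upd_def vec_eq_iff)
      have z: "z (Inl 0) = fst (point_at z)" "z (Inr k) = snd (point_at z) $ k" for z :: "nat + 'n \<Rightarrow> complex" and k
        by (auto simp: point_at_def)
      have im: "W = point_at ` ?D"
      proof -
        have "point_at ` topspace (subtopology (cspace ?J) ?D) = topspace (subtopology euclidean W)"
          using hom homeomorphic_imp_surjective_map homeomorphic_maps_map by blast
        then show ?thesis
          using openin_subset[OF D] by (simp add: inf.absorb2)
      qed
      have "?L \<longleftrightarrow> (\<forall>z\<in>?D. (\<lambda>w. ?g (w, snd (point_at z))) field_differentiable at (fst (point_at z)) \<and>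
         (\<forall>k. (\<lambda>w. ?g (fst (point_at z), vec_upd (snd (point_at z)) k w)) field_differentiable at (snd (point_at z) $ k)))"
        by (auto simp: 1 2 z Plus_def)
      also have "\<dots> \<longleftrightarrow> (\<forall>q\<in>point_at ` ?D. (\<lambda>t. ?g (t, snd q)) field_differentiable at (fst q) \<and>
          (\<forall>k. (\<lambda>t. ?g (fst q, vec_upd (snd q) k t)) field_differentiable at (snd q $ k)))"
        by blast
      also have "\<dots> \<longleftrightarrow> ?R"
        unfolding im[symmetric] by (simp add: case_prod_unfold)
      finally show ?thesis .
    qed
    ultimately show ?thesis
      using D by (simp add: holo_on_def separately_holomorphic_on_def)
  qed
  finally show ?thesis .
qed

section \<open>Stein open subsets of \<open>\<complex> \<times> \<complex>\<^sup>n\<close>\<close>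

lemma points_mfd_over: "points (mfd_over W) = over W"
  using topspace_over[of W] by (simp add: mfd_over_eq)

lemma of_model_in_over: "of_model q \<in> over W \<longleftrightarrow> q \<in> W"
  by (simp add: over_def)

lemma compactin_over_iff:
  fixes W :: "(complex \<times> (complex ^ 'n)) set"
  shows "compactin (subtopology ambient (over W)) K \<longleftrightarrow> K \<subseteq> over W \<and> compact (to_model ` K)"
proof -
  have h: "homeomorphic_map (subtopology ambient (over W)) (subtopology euclidean W) to_model"
    using homeomorphic_maps_over homeomorphic_maps_map by blast
  have "to_model ` K \<subseteq> W" if "K \<subseteq> over W"
    using that to_model_over[of W] by blast
  then show ?thesis
    using homeomorphic_map_compactness_eq[OF h, of K] unfolding topspace_over
    by (auto simp: compactin_subtopology)
qed

definition holo_hull_in :: "(complex \<times> (complex ^ 'n)) set \<Rightarrow> (complex \<times> (complex ^ 'n)) set \<Rightarrow> (complex \<times> (complex ^ 'n)) set" where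
  "holo_hull_in W K =
     {q \<in> W. \<forall>g. separately_holomorphic_on W g \<longrightarrow> norm (g q) \<le> (SUP p\<in>K. norm (g p))}"

lemma holo_hull_mfd_over:
  fixes W :: "(complex \<times> (complex ^ 'n)) set"
  assumes W: "open W" and K: "K \<subseteq> over W"
  shows "to_model ` holo_hull (mfd_over W) K = holo_hull_in W (to_model ` K)"
proof (intro equalityI subsetI)
  have id: "of_model (to_model p) = p" if "p \<in> over W" for p
    using that by (simp add: over_def of_model_to_model)
  fix q assume "q \<in> to_model ` holo_hull (mfd_over W) K"
  then obtain p where p: "p \<in> holo_hull (mfd_over W) K" "q = to_model p" by auto
  have pW: "p \<in> over W" using p by (simp add: holo_hull_def points_mfd_over)
  have "norm (g q) \<le> (SUP x\<in>to_model ` K. norm (g x))" if g: "separately_holomorphic_on W g" for g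
  proof -
    have "g \<circ> to_model \<in> holo_functions (mfd_over W)"
      using g by (simp add: holo_functions_mfd_over[OF W] o_def)
    then show ?thesis
      using p by (auto simp: holo_hull_def image_image)
  qed
  then show "q \<in> holo_hull_in W (to_model ` K)"
    using pW p(2) by (simp add: holo_hull_in_def over_def)
next
  fix q assume q: "q \<in> holo_hull_in W (to_model ` K)"
  have "norm (f (of_model q)) \<le> (SUP p\<in>K. norm (f p))" if "f \<in> holo_functions (mfd_over W)" for f
  proof -
    have "norm (f (of_model q)) \<le> (SUP p\<in>K. norm (f (of_model (to_model p))))"
      using q that by (auto simp: holo_functions_mfd_over[OF W] holo_hull_in_def image_image)
    also have "\<dots> = (SUP p\<in>K. norm (f p))"
      using K by (intro SUP_cong refl) (auto simp: over_def of_model_to_model subset_iff)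
    finally show ?thesis .
  qed
  moreover have "of_model q \<in> points (mfd_over W)"
    using q by (simp add: points_mfd_over of_model_in_over holo_hull_in_def)
  ultimately have "of_model q \<in> holo_hull (mfd_over W) K"
    by (simp add: holo_hull_def)
  then show "q \<in> to_model ` holo_hull (mfd_over W) K"
    by (intro image_eqI[of _ _ "of_model q"]) simp
qed

lemma separately_holomorphic_on_const: "separately_holomorphic_on W (\<lambda>_. c)"
  by (auto simp: separately_holomorphic_on_def)

lemma separately_holomorphic_on_fst: "separately_holomorphic_on W fst"
  by (auto simp: separately_holomorphic_on_def intro!: continuous_intros)

lemma separately_holomorphic_on_snd:
  fixes W :: "(complex \<times> (complex ^ 'n)) set"
  shows "separately_holomorphic_on W (\<lambda>q. snd q $ k)"
proof -
  have "(\<lambda>t. vec_upd x l t $ k) field_differentiable at a" for x :: "complex ^ 'n" and l a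
    by (cases "k = l") (auto simp: vec_upd_def)
  then show ?thesis
    by (auto simp: separately_holomorphic_on_def intro!: continuous_intros)
qed

lemma separately_holomorphic_on_add:
  "separately_holomorphic_on W f \<Longrightarrow> separately_holomorphic_on W g \<Longrightarrow> separately_holomorphic_on W (\<lambda>q. f q + g q)"
  by (auto simp: separately_holomorphic_on_def intro!: continuous_intros field_differentiable_add)

lemma separately_holomorphic_on_mult:
  "separately_holomorphic_on W f \<Longrightarrow> separately_holomorphic_on W g \<Longrightarrow> separately_holomorphic_on W (\<lambda>q. f q * g q)"
  by (fastforce simp: separately_holomorphic_on_def intro!: continuous_intros field_differentiable_mult)

lemma separately_holomorphic_on_power:
  "separately_holomorphic_on W f \<Longrightarrow> separately_holomorphic_on W (\<lambda>q. f q ^ m)"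
  by (induction m) (auto intro: separately_holomorphic_on_const separately_holomorphic_on_mult)

lemma separately_holomorphic_on_sum:
  "(\<And>i. i \<in> I \<Longrightarrow> separately_holomorphic_on W (f i)) \<Longrightarrow> separately_holomorphic_on W (\<lambda>q. \<Sum>i\<in>I. f i q)"
  by (induction I rule: infinite_finite_induct)
    (auto intro: separately_holomorphic_on_const separately_holomorphic_on_add)

lemma separately_holomorphic_on_subset:
  "separately_holomorphic_on W f \<Longrightarrow> V \<subseteq> W \<Longrightarrow> separately_holomorphic_on V f"
  unfolding separately_holomorphic_on_def using continuous_on_subset by blast

lemmas separately_holomorphic_intros =
  separately_holomorphic_on_const separately_holomorphic_on_fst separately_holomorphic_on_snd
  separately_holomorphic_on_add separately_holomorphic_on_mult separately_holomorphic_on_power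
  separately_holomorphic_on_sum

text \<open>
  On an open subset of \<open>\<complex> \<times> \<complex>\<^sup>n\<close> the coordinate functions separate points and are local coordinates, which leaves only
  holomorphic convexity to be checked.
\<close>

lemma stein_manifold_mfd_over_iff:
  fixes W :: "(complex \<times> (complex ^ 'n)) set"
  assumes W: "open W"
  shows "stein_manifold (mfd_over W) \<longleftrightarrow>
    (\<forall>K. compact K \<and> K \<noteq> {} \<and> K \<subseteq> W \<longrightarrow> compact (holo_hull_in W K))" (is "_ = ?R")
proof -
  let ?M = "mfd_over W"
  have hull: "compactin (mtop ?M) (holo_hull ?M K) \<longleftrightarrow> compact (holo_hull_in W (to_model ` K))" if "K \<subseteq> over W" for K
  proof -
    have "holo_hull ?M K \<subseteq> over W" by (auto simp: holo_hull_def points_mfd_over)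
    then show ?thesis
      using holo_hull_mfd_over[OF W that] by (simp add: mfd_over_eq compactin_over_iff)
  qed
  have h1: "(\<forall>K. compactin (mtop ?M) K \<and> K \<noteq> {} \<longrightarrow> compactin (mtop ?M) (holo_hull ?M K)) \<longleftrightarrow> ?R" (is "?L = _")
  proof
    assume L: ?L
    show ?R
    proof (intro allI impI)
      fix K assume K: "compact K \<and> K \<noteq> {} \<and> K \<subseteq> W"
      have im: "to_model ` of_model ` K = K" by (simp add: image_image)
      have sub: "of_model ` K \<subseteq> over W" using K by (auto simp: over_def)
      have "compactin (mtop ?M) (of_model ` K)"
        using K sub im by (simp add: mfd_over_eq compactin_over_iff)
      then have "compactin (mtop ?M) (holo_hull ?M (of_model ` K))" using L K by blast
      then show "compact (holo_hull_in W K)" using hull[OF sub] im by simp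
    qed
  next
    assume R: ?R
    show ?L
    proof (intro allI impI)
      fix K assume K: "compactin (mtop ?M) K \<and> K \<noteq> {}"
      then have K': "K \<subseteq> over W" "compact (to_model ` K)" by (auto simp: mfd_over_eq compactin_over_iff)
      moreover have "to_model ` K \<subseteq> W" using K' to_model_over by blast
      ultimately show "compactin (mtop ?M) (holo_hull ?M K)" using R hull K by simp
    qed
  qed
  have h2: "\<exists>f\<in>holo_functions ?M. f p \<noteq> f q" if pq: "p \<in> points ?M" "q \<in> points ?M" "p \<noteq> q" for p q
  proof -
    have "of_model (to_model p) = p" "of_model (to_model q) = q"
      using pq by (simp_all add: points_mfd_over over_def of_model_to_model)
    then have ne: "to_model p \<noteq> to_model q"
      using pq(3) by metis
    have "\<exists>g. separately_holomorphic_on W g \<and> g (to_model p) \<noteq> g (to_model q)"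
    proof (cases "fst (to_model p) = fst (to_model q)")
      case True
      then obtain k where "snd (to_model p) $ k \<noteq> snd (to_model q) $ k"
        using ne by (auto simp: prod_eq_iff vec_eq_iff)
      then show ?thesis using separately_holomorphic_on_snd by metis
    next
      case False
      then show ?thesis using separately_holomorphic_on_fst by metis
    qed
    then obtain g where g: "separately_holomorphic_on W g" "g (to_model p) \<noteq> g (to_model q)" by blast
    have "g \<circ> to_model \<in> holo_functions ?M"
      using g by (simp add: holo_functions_mfd_over[OF W] o_def)
    then show ?thesis using g(2) by (intro bexI[of _ "g \<circ> to_model"]) auto
  qed
  have h3: "\<exists>U F. p \<in> U \<and> (\<forall>i\<in>midx ?M. F i \<in> holo_functions ?M) \<and>
        (let c = (U, \<lambda>x. \<lambda>i\<in>midx ?M. F i x) in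
           is_chart (mtop ?M) (midx ?M) c \<and>
           (\<forall>d\<in>atlas ?M. holo_transition (midx ?M) c d \<and> holo_transition (midx ?M) d c))"
    if p: "p \<in> points ?M" for p
  proof -
    let ?J = "{0} <+> (UNIV :: 'n set)" and ?F = "\<lambda>i p. coordinates p i"
    have c: "is_chart (subtopology ambient (over W)) ?J (over W, coordinates)"
      by (rule is_chart_coordinates[OF W])
    have eq: "(\<lambda>i\<in>?J. ?F i x) = coordinates x" if "x \<in> over W" for x
      using extensional_coordinates[of x] that extensional_restrict[of "coordinates x" ?J] by (auto simp: over_def)
    have "is_chart (subtopology ambient (over W)) ?J (over W, \<lambda>x. \<lambda>i\<in>?J. ?F i x)"
    proof -
      have im: "(\<lambda>x. \<lambda>i\<in>?J. ?F i x) ` over W = coordinates ` over W"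
        by (rule image_cong[OF refl eq])
      show ?thesis
        using c eq im unfolding is_chart_def
        by (auto elim!: homeomorphic_map_eq simp: topspace_over subtopology_subtopology)
    qed
    moreover have "?F i \<in> holo_functions ?M" if "i \<in> ?J" for i
    proof -
      have "(?F i \<circ> of_model) = fst \<or> (\<exists>k. (?F i \<circ> of_model) = (\<lambda>q. snd q $ k))"
        using that by (auto simp: coordinates_def of_model_def fun_eq_iff)
      then show ?thesis
        unfolding holo_functions_mfd_over[OF W]
        by (metis separately_holomorphic_on_fst separately_holomorphic_on_snd)
    qed
    ultimately show ?thesis
      using p c eq
      by (intro exI[of _ "over W"] exI[of _ ?F])
        (auto simp: points_mfd_over, auto simp: mfd_over_eq Let_def intro!: holo_transition_same_chart)
  qed
  show ?thesis
    unfolding stein_manifold_def h1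
    by (intro iffI conjI ballI impI complex_manifold_mfd_over[OF W] h2 h3; (elim conjE)?; assumption)
qed

section \<open>Holomorphic convexity of sublevel sets of sums of squares\<close>

text \<open>
  If \<open>N\<close> is the diagonal of a positive definite kernel \<open>K\<close> that is holomorphic in its first variable, then \<open>f p = K p p\<^sub>0\<close>
  satisfies \<open>f p\<^sub>0 = N p\<^sub>0\<close> and, by the Cauchy-Schwarz inequality, \<open>\<bar>f p\<bar>\<^sup>2 \<le> N p * N p\<^sub>0\<close>. The latter makes the sublevel
  sets of \<open>N\<close> holomorphically convex. Allowing an error \<open>\<epsilon>\<close> at \<open>p\<^sub>0\<close> means that finite parts of the
  expansion of \<open>K\<close> suffice, so no convergence of series of holomorphic functions has to be discussed.
\<close>

definition reproducible :: "(complex \<times> (complex ^ 'n) \<Rightarrow> real) \<Rightarrow> bool" where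
  "reproducible N \<longleftrightarrow> (\<forall>p\<^sub>0. \<forall>\<epsilon>>0. \<exists>f r. separately_holomorphic_on UNIV f \<and>
     f p\<^sub>0 = of_real r \<and> N p\<^sub>0 - \<epsilon> \<le> r \<and> (\<forall>p. (norm (f p))\<^sup>2 \<le> N p * N p\<^sub>0)) \<and> (\<forall>p. 0 \<le> N p)"

lemma reproducible_nonneg: "reproducible N \<Longrightarrow> 0 \<le> N p"
  unfolding reproducible_def by blast

lemma reproducibleE:
  assumes "reproducible N" "\<epsilon> > 0"
  obtains f r where "separately_holomorphic_on UNIV f" "f p\<^sub>0 = of_real r" "N p\<^sub>0 - \<epsilon> \<le> r"
    "\<And>p. (norm (f p))\<^sup>2 \<le> N p * N p\<^sub>0"
proof -
  have "\<exists>f r. separately_holomorphic_on UNIV f \<and> f p\<^sub>0 = of_real r \<and> N p\<^sub>0 - \<epsilon> \<le> r \<and>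
      (\<forall>p. (norm (f p))\<^sup>2 \<le> N p * N p\<^sub>0)"
    using assms unfolding reproducible_def by blast
  then show thesis using that by blast
qed

lemma reproducible_add:
  assumes M: "reproducible M" and N: "reproducible N"
  shows "reproducible (\<lambda>p. M p + N p)"
  unfolding reproducible_def
proof (intro conjI allI impI)
  have pos: "0 \<le> M p" "0 \<le> N p" for p
    using reproducible_nonneg[OF M] reproducible_nonneg[OF N] by blast+
  show "0 \<le> M p + N p" for p using pos by (simp add: add_nonneg_nonneg)
  fix p0 and \<epsilon> :: real assume "\<epsilon> > 0"
  then have e: "\<epsilon> / 2 > 0" by simp
  obtain f r where f: "separately_holomorphic_on UNIV f" "f p0 = of_real r" "M p0 - \<epsilon> / 2 \<le> r"
      "\<And>p. (norm (f p))\<^sup>2 \<le> M p * M p0"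
    by (rule reproducibleE[OF M e, where p\<^sub>0 = p0]) blast
  obtain g s where g: "separately_holomorphic_on UNIV g" "g p0 = of_real s" "N p0 - \<epsilon> / 2 \<le> s"
      "\<And>p. (norm (g p))\<^sup>2 \<le> N p * N p0"
    by (rule reproducibleE[OF N e, where p\<^sub>0 = p0]) blast
  have "(norm (f p + g p))\<^sup>2 \<le> (M p + N p) * (M p0 + N p0)" for p
  proof -
    have "norm (f p + g p) \<le> norm (f p) + norm (g p)" by (rule norm_triangle_ineq)
    also have "\<dots> \<le> sqrt (M p) * sqrt (M p0) + sqrt (N p) * sqrt (N p0)"
      using f(4)[of p] g(4)[of p] by (intro add_mono) (simp_all add: real_le_rsqrt real_sqrt_mult[symmetric])
    finally have "(norm (f p + g p))\<^sup>2 \<le> (sqrt (M p) * sqrt (M p0) + sqrt (N p) * sqrt (N p0))\<^sup>2"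
      by (rule power_mono) simp
    also have "\<dots> \<le> ((sqrt (M p))\<^sup>2 + (sqrt (N p))\<^sup>2) * ((sqrt (M p0))\<^sup>2 + (sqrt (N p0))\<^sup>2)"
    proof -
      have "(a * b + c * d)\<^sup>2 \<le> (a\<^sup>2 + c\<^sup>2) * (b\<^sup>2 + d\<^sup>2)" for a b c d :: real
        using zero_le_power2[of "a * d - c * b"] by (simp add: power2_eq_square algebra_simps)
      then show ?thesis .
    qed
    finally show ?thesis using pos by simp
  qed
  then show "\<exists>h r. separately_holomorphic_on UNIV h \<and> h p0 = of_real r \<and> M p0 + N p0 - \<epsilon> \<le> r \<and>
      (\<forall>p. (norm (h p))\<^sup>2 \<le> (M p + N p) * (M p0 + N p0))"
    using f g by (intro exI[of _ "\<lambda>p. f p + g p"] exI[of _ "r + s"])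
      (auto intro: separately_holomorphic_on_add)
qed

lemma reproducible_mult_norm:
  assumes N: "reproducible N" and h: "separately_holomorphic_on UNIV h"
  shows "reproducible (\<lambda>p. (norm (h p))\<^sup>2 * N p)"
  unfolding reproducible_def
proof (intro conjI allI impI)
  show "0 \<le> (norm (h p))\<^sup>2 * N p" for p using reproducible_nonneg[OF N] by simp
  fix p0 and \<epsilon> :: real assume "\<epsilon> > 0"
  \<comment> \<open>The value of \<open>N\<close> at \<open>p0\<close> gets multiplied by \<open>c\<close>, possibly zero, whence the error \<open>\<epsilon> / (1 + c)\<close> for \<open>N\<close>.\<close>
  define c where "c = (norm (h p0))\<^sup>2"
  have c: "c \<ge> 0" by (simp add: c_def)
  with \<open>\<epsilon> > 0\<close> have e: "\<epsilon> / (1 + c) > 0" by (simp add: add_pos_nonneg)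
  obtain f r where f: "separately_holomorphic_on UNIV f" "f p0 = of_real r" "N p0 - \<epsilon> / (1 + c) \<le> r"
      "\<And>p. (norm (f p))\<^sup>2 \<le> N p * N p0"
    by (rule reproducibleE[OF N e, where p\<^sub>0 = p0]) blast
  let ?g = "\<lambda>p. cnj (h p0) * h p * f p"
  have "?g p0 = of_real (c * r)"
    unfolding c_def of_real_mult complex_norm_square f(2) by (simp add: mult.commute)
  moreover have "c * N p0 - \<epsilon> \<le> c * r"
  proof -
    have "c * (N p0 - \<epsilon> / (1 + c)) \<le> c * r" using f(3) c by (rule mult_left_mono)
    moreover have "c * (\<epsilon> / (1 + c)) \<le> \<epsilon>" using c \<open>\<epsilon> > 0\<close> by (simp add: field_simps)
    ultimately show ?thesis by (simp add: right_diff_distrib)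
  qed
  moreover have "(norm (?g p))\<^sup>2 \<le> (norm (h p))\<^sup>2 * N p * (c * N p0)" for p
    using mult_left_mono[OF f(4)[of p], of "c * (norm (h p))\<^sup>2"] c
    by (simp add: norm_mult power_mult_distrib c_def mult_ac)
  moreover have "separately_holomorphic_on UNIV ?g"
    by (intro separately_holomorphic_intros h f(1))
  ultimately show "\<exists>g r. separately_holomorphic_on UNIV g \<and> g p0 = of_real r \<and> (norm (h p0))\<^sup>2 * N p0 - \<epsilon> \<le> r \<and>
      (\<forall>p. (norm (g p))\<^sup>2 \<le> (norm (h p))\<^sup>2 * N p * ((norm (h p0))\<^sup>2 * N p0))"
    by (intro exI[of _ ?g] exI[of _ "c * r"]) (simp add: c_def)
qed

lemma reproducible_scale:
  assumes "reproducible N" "c \<ge> 0"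
  shows "reproducible (\<lambda>p. c * N p)"
  using reproducible_mult_norm[OF assms(1) separately_holomorphic_on_const[of _ "of_real (sqrt c)"]] assms(2)
  by simp

lemma reproducible_sum:
  assumes "finite I" "\<And>i. i \<in> I \<Longrightarrow> reproducible (N i)"
  shows "reproducible (\<lambda>p. \<Sum>i\<in>I. N i p)"
  using assms
proof (induction I rule: finite_induct)
  case empty
  show ?case
    using separately_holomorphic_on_const[of UNIV 0] by (auto simp: reproducible_def intro!: exI[of _ "\<lambda>_. 0"] exI[of _ 0])
next
  case (insert i I)
  then show ?case using reproducible_add[of "N i" "\<lambda>p. \<Sum>i\<in>I. N i p"] by simp
qed

text \<open>
  The functions \<open>f\<close> are the partial sums of \<open>\<Sum>j. V j p * cnj (V j p\<^sub>0)\<close>.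
\<close>

lemma reproducible_sums:
  fixes V :: "nat \<Rightarrow> complex \<times> (complex ^ 'n) \<Rightarrow> complex"
  assumes V: "\<And>j. separately_holomorphic_on UNIV (V j)"
    and N: "\<And>p. (\<lambda>j. (norm (V j p))\<^sup>2) sums N p"
  shows "reproducible N"
  unfolding reproducible_def
proof (intro conjI allI impI)
  have le: "(\<Sum>j<m. (norm (V j p))\<^sup>2) \<le> N p" for m p
    using sum_le_suminf[OF sums_summable[OF N], of "{..<m}" p] sums_unique[OF N] by simp
  show pos: "0 \<le> N p" for p using le[of p 0] by simp
  fix p0 and \<epsilon> :: real assume "\<epsilon> > 0"
  then have "\<forall>\<^sub>F m in sequentially. (\<Sum>j<m. (norm (V j p0))\<^sup>2) > N p0 - \<epsilon>"
    using N[of p0] unfolding sums_def by (intro order_tendstoD) auto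
  then obtain m where m: "(\<Sum>j<m. (norm (V j p0))\<^sup>2) > N p0 - \<epsilon>"
    using eventually_happens'[OF sequentially_bot] by blast
  let ?f = "\<lambda>p. \<Sum>j<m. cnj (V j p0) * V j p"
  have "?f p0 = of_real (\<Sum>j<m. (norm (V j p0))\<^sup>2)"
    unfolding of_real_sum complex_norm_square by (simp add: mult.commute)
  moreover have "(norm (?f p))\<^sup>2 \<le> N p * N p0" for p
  proof -
    have "norm (?f p) \<le> (\<Sum>j<m. norm (V j p) * norm (V j p0))"
      by (rule sum_norm_le) (simp add: norm_mult mult.commute)
    then have "(norm (?f p))\<^sup>2 \<le> (\<Sum>j<m. norm (V j p) * norm (V j p0))\<^sup>2"
      by (rule power_mono) simp
    also have "\<dots> \<le> (\<Sum>j<m. (norm (V j p))\<^sup>2) * (\<Sum>j<m. (norm (V j p0))\<^sup>2)"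
      by (rule Cauchy_Schwarz_ineq_sum)
    also have "\<dots> \<le> N p * N p0"
      by (intro mult_mono le sum_nonneg pos) auto
    finally show ?thesis .
  qed
  moreover have "separately_holomorphic_on UNIV ?f"
    by (intro separately_holomorphic_intros V)
  ultimately show "\<exists>f r. separately_holomorphic_on UNIV f \<and> f p0 = of_real r \<and> N p0 - \<epsilon> \<le> r \<and>
      (\<forall>p. (norm (f p))\<^sup>2 \<le> N p * N p0)"
    using m by (intro exI[of _ ?f] exI[of _ "\<Sum>j<m. (norm (V j p0))\<^sup>2"]) auto
qed

text \<open>
  Let \<open>N \<le> m < 1\<close> on \<open>K\<close> and let \<open>p\<^sub>0\<close> lie in the hull. The function \<open>f\<close> belonging to \<open>p\<^sub>0\<close> satisfies
  \<open>\<bar>f\<bar> \<le> sqrt (m * N p\<^sub>0)\<close> on \<open>K\<close>, hence \<open>N p\<^sub>0 \<le> sqrt (m * N p\<^sub>0)\<close> up to an arbitrary error, that is, \<open>N p\<^sub>0 \<le> m\<close>.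
  So the hull stays away from the boundary; it is bounded because of the coordinate functions.
\<close>

lemma stein_manifold_sublevel:
  fixes N :: "complex \<times> (complex ^ 'n) \<Rightarrow> real"
  assumes N: "reproducible N" and cont: "continuous_on UNIV N"
  shows "stein_manifold (mfd_over {q. N q < 1})"
proof -
  let ?W = "{q. N q < 1}"
  have W: "open ?W"
    by (rule open_Collect_less[OF cont continuous_on_const])
  show ?thesis
    unfolding stein_manifold_mfd_over_iff[OF W]
  proof (intro allI impI)
    fix K assume K: "compact K \<and> K \<noteq> {} \<and> K \<subseteq> ?W"
    have pos: "0 \<le> N p" for p by (rule reproducible_nonneg[OF N])
    obtain a where a: "a \<in> K" "\<And>q. q \<in> K \<Longrightarrow> N q \<le> N a"
      using continuous_attains_sup[of K N] K continuous_on_subset[OF cont] by auto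
    have N_hull: "N p0 \<le> N a" if p0: "p0 \<in> holo_hull_in ?W K" for p0
    proof -
      have le: "N p0 - \<epsilon> \<le> sqrt (N a * N p0)" if e: "\<epsilon> > 0" for \<epsilon>
      proof -
        obtain f r where f: "separately_holomorphic_on UNIV f" "f p0 = of_real r" "N p0 - \<epsilon> \<le> r"
            "\<And>p. (norm (f p))\<^sup>2 \<le> N p * N p0"
          by (rule reproducibleE[OF N e, where p\<^sub>0 = p0]) blast
        have "norm (f p) \<le> sqrt (N a * N p0)" if "p \<in> K" for p
          by (rule real_le_rsqrt, rule order_trans[OF f(4) mult_right_mono[OF a(2)[OF that] pos]])
        then have "(SUP p\<in>K. norm (f p)) \<le> sqrt (N a * N p0)"
          using K by (intro cSUP_least) auto
        moreover have "norm (f p0) \<le> (SUP p\<in>K. norm (f p))"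
          using p0 separately_holomorphic_on_subset[OF f(1)] by (auto simp: holo_hull_in_def)
        ultimately show ?thesis using f(2,3) by simp
      qed
      have "N p0 \<le> sqrt (N a * N p0)"
      proof (rule field_le_epsilon)
        fix e :: real assume "0 < e"
        from le[OF this] show "N p0 \<le> sqrt (N a * N p0) + e" by simp
      qed
      then have "(N p0)\<^sup>2 \<le> N a * N p0"
        using power_mono[OF _ pos[of p0], of "sqrt (N a * N p0)" 2] pos by simp
      then show ?thesis
        using pos[of p0] pos[of a] by (cases "N p0 = 0") (auto simp: power2_eq_square)
    qed
    have bnd: "norm (f p) \<le> (SUP p\<in>K. norm (f p))" if "separately_holomorphic_on ?W f" "p \<in> holo_hull_in ?W K" for f p
      using that by (auto simp: holo_hull_in_def)
    \<comment> \<open>A closed subset of \<open>\<complex> \<times> \<complex>\<^sup>n\<close> that contains the hull and on which all the functions \<open>g\<close> are continuous.\<close>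
    define C where "C = {q. N q \<le> N a}"
    have "bounded (holo_hull_in ?W K)"
    proof -
      define B where "B = (SUP p\<in>K. norm (fst p)) + (\<Sum>k\<in>UNIV. SUP p\<in>K. norm (snd p $ k))"
      have "norm p \<le> B" if "p \<in> holo_hull_in ?W K" for p
      proof -
        have "norm p \<le> norm (fst p) + norm (snd p)" by (metis norm_Pair_le prod.collapse)
        also have "norm (fst p) \<le> (SUP p\<in>K. norm (fst p))"
          by (rule bnd[OF separately_holomorphic_on_fst that])
        also have "norm (snd p) \<le> (\<Sum>k\<in>UNIV. norm (snd p $ k))"
          unfolding norm_vec_def by (rule L2_set_le_sum) simp
        also have "\<dots> \<le> (\<Sum>k\<in>UNIV. SUP p\<in>K. norm (snd p $ k))"
          by (intro sum_mono bnd[OF separately_holomorphic_on_snd that])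
        finally show ?thesis
          unfolding B_def by simp
      qed
      then show ?thesis unfolding bounded_iff by blast
    qed
    moreover have "closed (holo_hull_in ?W K)"
    proof -
      have C: "closed C" unfolding C_def by (rule closed_Collect_le[OF cont continuous_on_const])
      have CW: "C \<subseteq> ?W" using a K by (auto simp: C_def)
      define G where "G = {g. separately_holomorphic_on ?W g}"
      have "closed {q \<in> C. norm (g q) \<le> (SUP p\<in>K. norm (g p))}" if "g \<in> G" for g
      proof -
        have "continuous_on C (\<lambda>q. norm (g q))"
          using that CW by (auto simp: G_def separately_holomorphic_on_def intro!: continuous_intros intro: continuous_on_subset)
        from continuous_closed_preimage[OF this C closed_atMost[of "SUP p\<in>K. norm (g p)"]]
        show ?thesis by (simp add: vimage_def Int_def conj_commute)
      qed
      then have "closed (\<Inter>g\<in>G. {q \<in> C. norm (g q) \<le> (SUP p\<in>K. norm (g p))})"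
        by blast
      moreover have "holo_hull_in ?W K = (\<Inter>g\<in>G. {q \<in> C. norm (g q) \<le> (SUP p\<in>K. norm (g p))})"
      proof -
        have "(\<lambda>_. 0) \<in> G" by (simp add: G_def separately_holomorphic_on_const)
        then show ?thesis
          using N_hull CW by (auto simp: C_def G_def) (auto simp: holo_hull_in_def)
      qed
      ultimately show ?thesis by simp
    qed
    ultimately show "compact (holo_hull_in ?W K)"
      by (simp add: compact_eq_bounded_closed)
  qed
qed

section \<open>The quartic body\<close>

text \<open>
  The derivatives of a polynomial in fixed directions are again polynomials, which makes the induction on the
  order of differentiability work.
\<close>

lemma real_polynomial_has_derivative:
  fixes f :: "'a::euclidean_space \<Rightarrow> real"
  assumes "real_polynomial_function f"
  shows "\<exists>f'. (\<forall>x. (f has_derivative f' x) (at x)) \<and> (\<forall>v. real_polynomial_function (\<lambda>x. f' x v))"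
  using assms
proof (induction rule: real_polynomial_function.induct)
  case (linear f)
  then show ?case
    by (intro exI[of _ "\<lambda>_. f"]) (auto intro: bounded_linear_imp_has_derivative)
next
  case (const c)
  show ?case by (intro exI[of _ "\<lambda>_ _. 0"]) auto
next
  case (add f g)
  then obtain f' g' where "\<forall>x. (f has_derivative f' x) (at x)" "\<forall>v. real_polynomial_function (\<lambda>x. f' x v)"
    "\<forall>x. (g has_derivative g' x) (at x)" "\<forall>v. real_polynomial_function (\<lambda>x. g' x v)" by blast
  then show ?case
    by (intro exI[of _ "\<lambda>x v. f' x v + g' x v"]) (auto intro: has_derivative_add)
next
  case (mult f g)
  then obtain f' g' where "\<forall>x. (f has_derivative f' x) (at x)" "\<forall>v. real_polynomial_function (\<lambda>x. f' x v)"
    "\<forall>x. (g has_derivative g' x) (at x)" "\<forall>v. real_polynomial_function (\<lambda>x. g' x v)" by blast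
  then show ?case using mult.hyps
    by (intro exI[of _ "\<lambda>x v. f x * g' x v + f' x v * g x"]) (auto intro!: has_derivative_mult real_polynomial_function.intros(3,4))
qed

lemma Cinf_on_real_polynomial:
  fixes f :: "'a::euclidean_space \<Rightarrow> real"
  assumes "real_polynomial_function f"
  shows "Cinf_on U f"
proof -
  have "Ck_on k U f" for k
    using assms
  proof (induction k arbitrary: f)
    case 0
    obtain f' where "\<And>x. (f has_derivative f' x) (at x)"
      using real_polynomial_has_derivative[OF 0] by blast
    then show ?case
      by (auto intro!: continuous_at_imp_continuous_on has_derivative_continuous)
  next
    case (Suc k)
    obtain f' where f': "\<And>x. (f has_derivative f' x) (at x)" "\<And>v. real_polynomial_function (\<lambda>x. f' x v)"
      using real_polynomial_has_derivative[OF Suc.prems] by blast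
    then have "frechet_derivative f (at x) = f' x" for x
      using frechet_derivative_at by metis
    then show ?case
      using Suc.IH f' by (auto simp: differentiable_def)
  qed
  then show ?thesis by (simp add: Cinf_on_def)
qed

lemma real_polynomial_inner_linear:
  fixes A :: "'a::euclidean_space \<Rightarrow> 'b::euclidean_space"
  assumes "linear A"
  shows "real_polynomial_function (\<lambda>x. A x \<bullet> A x)"
proof -
  have "bounded_linear (\<lambda>x. A x \<bullet> b)" for b
    using assms by (simp add: bounded_linear_inner_left_comp linear_conv_bounded_linear)
  then show ?thesis
    by (subst euclidean_inner) (intro real_polynomial_function_sum real_polynomial_function.intros(4) real_polynomial_function.intros(1) finite_Basis)
qed

text \<open>
  A perturbation of the fourth power of the norm. It is written with real inner products because the boundary
  is studied by real differentiation.
\<close>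

definition quartic :: "'n \<Rightarrow> 'n \<Rightarrow> complex ^ 'n \<Rightarrow> real" where
  "quartic i j y = (y \<bullet> y)\<^sup>2 + 1/4 * ((y $ i \<bullet> y $ i) * (y $ j \<bullet> y $ j))"

definition quartic_deriv :: "'n \<Rightarrow> 'n \<Rightarrow> complex ^ 'n \<Rightarrow> complex ^ 'n \<Rightarrow> real" where
  "quartic_deriv i j y v = 4 * (y \<bullet> y) * (y \<bullet> v) +
     1/2 * ((y $ i \<bullet> v $ i) * (y $ j \<bullet> y $ j) + (y $ i \<bullet> y $ i) * (y $ j \<bullet> v $ j))"

definition quartic_deriv2 :: "'n \<Rightarrow> 'n \<Rightarrow> complex ^ 'n \<Rightarrow> complex ^ 'n \<Rightarrow> complex ^ 'n \<Rightarrow> real" where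
  "quartic_deriv2 i j y v w = 8 * (y \<bullet> w) * (y \<bullet> v) + 4 * (y \<bullet> y) * (w \<bullet> v) +
     1/2 * ((w $ i \<bullet> v $ i) * (y $ j \<bullet> y $ j) + 2 * (y $ i \<bullet> v $ i) * (y $ j \<bullet> w $ j) +
            2 * (y $ i \<bullet> w $ i) * (y $ j \<bullet> v $ j) + (y $ i \<bullet> y $ i) * (w $ j \<bullet> v $ j))"

lemma quartic_ge: "(norm y) ^ 4 \<le> quartic i j y"
proof -
  have "(norm y) ^ 4 = (y \<bullet> y)\<^sup>2"
    unfolding dot_square_norm by simp
  then show ?thesis by (simp add: quartic_def)
qed

lemma quartic_deriv_self: "quartic_deriv i j y y = 4 * quartic i j y"
  by (simp add: quartic_deriv_def quartic_def power2_eq_square)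

text \<open>
  The only term of the second derivative that can be negative is \<open>2 (y\<^sub>i \<bullet> v\<^sub>i) (y\<^sub>j \<bullet> v\<^sub>j)\<close>. Half of it is absorbed by the
  other terms that come from \<open>\<bar>y\<^sub>i\<bar>\<^sup>2 \<bar>y\<^sub>j\<bar>\<^sup>2\<close>, the other half by a quarter of \<open>4 \<bar>y\<bar>\<^sup>2 \<bar>v\<bar>\<^sup>2\<close>.
\<close>

lemma quartic_deriv2_ge:
  "3 * (norm y)\<^sup>2 * (norm v)\<^sup>2 \<le> quartic_deriv2 i j y v v"
proof -
  define p q a b where "p = norm (y $ i)" and "q = norm (y $ j)" and "a = norm (v $ i)" and "b = norm (v $ j)"
  have nn: "0 \<le> p" "0 \<le> q" "0 \<le> a" "0 \<le> b" by (auto simp: p_def q_def a_def b_def)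
  have le: "p \<le> norm y" "q \<le> norm y" "a \<le> norm v" "b \<le> norm v"
    by (auto simp: p_def q_def a_def b_def Finite_Cartesian_Product.norm_nth_le)
  have "\<bar>(y $ i \<bullet> v $ i) * (y $ j \<bullet> v $ j)\<bar> \<le> (p * a) * (q * b)"
    unfolding abs_mult p_def q_def a_def b_def by (intro mult_mono Cauchy_Schwarz_ineq2) auto
  then have 1: "(y $ i \<bullet> v $ i) * (y $ j \<bullet> v $ j) \<ge> - ((p * a) * (q * b))" by linarith
  have 2: "a\<^sup>2 * q\<^sup>2 + p\<^sup>2 * b\<^sup>2 \<ge> 2 * ((p * a) * (q * b))"
    using zero_le_power2[of "a * q - p * b"] by (simp add: power2_eq_square algebra_simps)
  have 3: "(p * a) * (q * b) \<le> (norm y * norm v) * (norm y * norm v)"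
    using nn le by (intro mult_mono) auto
  have "quartic_deriv2 i j y v v = 8 * (y \<bullet> v)\<^sup>2 + 4 * ((norm y)\<^sup>2 * (norm v)\<^sup>2)
      + 1/2 * (a\<^sup>2 * q\<^sup>2 + p\<^sup>2 * b\<^sup>2) + 2 * ((y $ i \<bullet> v $ i) * (y $ j \<bullet> v $ j))"
    by (simp add: quartic_deriv2_def p_def q_def a_def b_def dot_square_norm power2_eq_square algebra_simps)
  also have "\<dots> \<ge> 3 * ((norm y)\<^sup>2 * (norm v)\<^sup>2)"
  proof -
    have "3 * Y \<le> 8 * Z + 4 * Y + 1/2 * S + 2 * T" if "- X \<le> T" "2 * X \<le> S" "X \<le> Y" "0 \<le> Z" for X Y Z S T :: real
      using that by linarith
    moreover have "(p * a) * (q * b) \<le> (norm y)\<^sup>2 * (norm v)\<^sup>2"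
      using 3 by (simp add: power2_eq_square mult_ac)
    ultimately show ?thesis
      using 1 2 zero_le_power2 by blast
  qed
  finally show ?thesis by (simp add: mult.assoc)
qed

lemma has_derivative_linear_nth:
  fixes B :: "'a::euclidean_space \<Rightarrow> complex ^ 'n"
  assumes "linear B"
  shows "((\<lambda>x. B x $ k) has_derivative (\<lambda>v. B v $ k)) (at x)"
  using assms by (intro bounded_linear_imp_has_derivative bounded_linear_vec_nth[THEN bounded_linear_compose])
    (simp add: linear_conv_bounded_linear)

lemma has_derivative_quartic:
  fixes B :: "complex ^ 'n \<Rightarrow> complex ^ 'n"
  assumes B: "linear B"
  shows "((\<lambda>x. quartic i j (B x)) has_derivative (\<lambda>v. quartic_deriv i j (B x) (B v))) (at x)"
    and "((\<lambda>x. quartic_deriv i j (B x) (B v)) has_derivative (\<lambda>w. quartic_deriv2 i j (B x) (B v) (B w))) (at x)"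
proof -
  note d = linear_imp_has_derivative[OF B] has_derivative_linear_nth[OF B]
  show "((\<lambda>x. quartic i j (B x)) has_derivative (\<lambda>v. quartic_deriv i j (B x) (B v))) (at x)"
    unfolding quartic_def quartic_deriv_def power2_eq_square
    by (rule derivative_eq_intros d refl)+ (simp add: algebra_simps inner_commute fun_eq_iff)
  show "((\<lambda>x. quartic_deriv i j (B x) (B v)) has_derivative (\<lambda>w. quartic_deriv2 i j (B x) (B v) (B w))) (at x)"
    unfolding quartic_deriv_def quartic_deriv2_def
    by (rule derivative_eq_intros d refl)+ (simp add: algebra_simps inner_commute fun_eq_iff)
qed

lemma convex_on_quartic:
  fixes B :: "complex ^ 'n \<Rightarrow> complex ^ 'n"
  assumes B: "linear B"
  shows "convex_on UNIV (\<lambda>x. quartic i j (B x))"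
proof (rule convex_onI)
  fix t :: real and x y :: "complex ^ 'n" assume t: "0 < t" "t < 1"
  define v where "v = y - x"
  let ?l = "\<lambda>t. x + t *\<^sub>R v"
  have l: "(?l has_derivative (\<lambda>h. h *\<^sub>R v)) (at t)" for t
    by (auto intro!: derivative_eq_intros)
  have scale: "B (h *\<^sub>R w) = h *\<^sub>R B w" for h w using B by (rule linear_scale)
  have q1: "((\<lambda>t. quartic i j (B (?l t))) has_real_derivative quartic_deriv i j (B (?l t)) (B v)) (at t)" for t
    using has_derivative_compose[OF l has_derivative_quartic(1)[OF B]] unfolding has_field_derivative_def scale
    by (rule has_derivative_eq_rhs) (simp add: quartic_deriv_def fun_eq_iff algebra_simps)
  have q2: "((\<lambda>t. quartic_deriv i j (B (?l t)) (B v)) has_real_derivative quartic_deriv2 i j (B (?l t)) (B v) (B v)) (at t)" for t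
    using has_derivative_compose[OF l has_derivative_quartic(2)[OF B]] unfolding has_field_derivative_def scale
    by (rule has_derivative_eq_rhs) (simp add: quartic_deriv2_def fun_eq_iff algebra_simps)
  have "0 \<le> quartic_deriv2 i j y v v" for y v :: "complex ^ 'n"
    by (rule order_trans[OF _ quartic_deriv2_ge]) simp
  then have "convex_on UNIV (\<lambda>t. quartic i j (B (?l t)))"
    using q1 q2 by (intro f''_ge0_imp_convex) auto
  from convex_onD[OF this, of t 0 1] t
  show "quartic i j (B ((1 - t) *\<^sub>R x + t *\<^sub>R y)) \<le> (1 - t) * quartic i j (B x) + t * quartic i j (B y)"
    by (simp add: v_def algebra_simps)
qed simp

text \<open>
  The single function \<open>quartic i j (B x) - 1\<close> defines the whole boundary: by homogeneity its derivative at \<open>x\<close> in the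
  direction \<open>x\<close> is four times the quartic, hence nonzero away from the origin, and its second
  derivative is positive there in every direction.
\<close>

lemma quartic_domain_strongly_convex:
  fixes B :: "complex ^ 'n \<Rightarrow> complex ^ 'n"
  assumes B: "linear B" and inj: "inj B"
  shows "{x. quartic i j (B x) < 1} \<in> strongly_convex_nbhds"
proof -
  let ?Y = "{x. quartic i j (B x) < 1}" and ?U = "- {0 :: complex ^ 'n}"
  define \<rho> where "\<rho> = (\<lambda>x. quartic i j (B x) - 1)"
  have B0: "B x = 0 \<longleftrightarrow> x = 0" for x
    using B inj by (simp add: linear_injective_0 linear_0 iffI)
  have cont: "continuous_on UNIV (\<lambda>x. quartic i j (B x))"
    using has_derivative_quartic(1)[OF B] by (auto intro!: continuous_at_imp_continuous_on has_derivative_continuous)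
  have "open ?Y" by (rule open_Collect_less[OF cont continuous_on_const])
  moreover have zero: "0 \<in> ?Y" using B0[of 0] by (simp add: quartic_def)
  moreover have "bounded ?Y"
  proof -
    obtain c where c: "c > 0" "\<And>x. norm (B x) \<ge> c * norm x"
      using linear_inj_bounded_below_pos[OF B inj] by blast
    have "norm x \<le> 1 / c" if "x \<in> ?Y" for x
    proof -
      have "(norm (B x)) ^ 4 < 1" using that quartic_ge[of "B x" i j] by simp
      then have "norm (B x) < 1" by (metis linorder_not_less one_le_power)
      then show ?thesis using c(1) c(2)[of x] by (simp add: field_simps)
    qed
    then show ?thesis unfolding bounded_iff by blast
  qed
  moreover have "convex ?Y"
  proof (rule convexI)
    fix x y and u v :: real assume xy: "x \<in> ?Y" "y \<in> ?Y" and uv: "0 \<le> u" "0 \<le> v" "u + v = 1"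
    have "quartic i j (B (u *\<^sub>R x + v *\<^sub>R y)) \<le> u * quartic i j (B x) + v * quartic i j (B y)"
      using convex_on_quartic[OF B, of i j] uv by (simp add: convex_on_def)
    also have "\<dots> < 1" using xy uv by (simp add: convex_bound_lt)
    finally show "u *\<^sub>R x + v *\<^sub>R y \<in> ?Y" by simp
  qed
  moreover have deriv: "frechet_derivative \<rho> (at x) = (\<lambda>v. quartic_deriv i j (B x) (B v))" for x
  proof -
    have "(\<rho> has_derivative (\<lambda>v. quartic_deriv i j (B x) (B v))) (at x)"
      unfolding \<rho>_def using has_derivative_diff[OF has_derivative_quartic(1)[OF B] has_derivative_const[of 1]] by simp
    then show ?thesis using frechet_derivative_at by metis
  qed
  have pos: "0 < quartic i j (B x)" if "x \<noteq> 0" for x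
  proof -
    have "0 < norm (B x) ^ 4" using that B0[of x] by simp
    then show ?thesis using quartic_ge[of "B x" i j] by linarith
  qed
  have ne: "quartic_deriv i j (B x) (B x) \<noteq> 0" if "x \<noteq> 0" for x
    using pos[OF that] by (simp add: quartic_deriv_self)
  have local: "local_defining_function ?Y p ?U \<rho>" if "p \<in> frontier ?Y" for p
  proof -
    have "p \<noteq> 0"
      using that zero \<open>open ?Y\<close> by (auto simp: frontier_def interior_open)
    moreover have "Cinf_on ?U \<rho>"
    proof (rule Cinf_on_real_polynomial)
      have n: "linear (\<lambda>x. B x $ k)" for k
        using linear_compose[OF B, of "\<lambda>y. y $ k"] by (simp add: o_def bounded_linear.linear bounded_linear_vec_nth)
      show "real_polynomial_function \<rho>"
        unfolding \<rho>_def quartic_def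
        by (intro real_polynomial_function_diff real_polynomial_function.intros(2,3,4) real_polynomial_function_power
            real_polynomial_inner_linear B n)
    qed
    moreover have "\<exists>v. frechet_derivative \<rho> (at x) v \<noteq> 0" if "x \<in> ?U" for x
      unfolding deriv using ne[of x] that by (intro exI[of _ x]) auto
    ultimately show ?thesis
      by (auto simp: local_defining_function_def \<rho>_def)
  qed
  then have "smooth_boundary ?Y" by (auto simp: smooth_boundary_def)
  moreover have "positive_normal_curvatures ?Y"
    unfolding positive_normal_curvatures_def
  proof (intro ballI exI conjI allI impI)
    fix p assume p: "p \<in> frontier ?Y"
    show "local_defining_function ?Y p ?U \<rho>" by (rule local[OF p])
    have p0: "p \<noteq> 0"
      using p zero \<open>open ?Y\<close> by (auto simp: frontier_def interior_open)
    fix v :: "complex ^ 'n" assume v: "v \<noteq> 0 \<and> frechet_derivative \<rho> (at p) v = 0"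
    have "frechet_derivative (\<lambda>x. frechet_derivative \<rho> (at x) v) (at p) v = quartic_deriv2 i j (B p) (B v) (B v)"
      unfolding deriv using frechet_derivative_at[OF has_derivative_quartic(2)[OF B]] by metis
    also have "\<dots> > 0"
      by (rule less_le_trans[OF _ quartic_deriv2_ge]) (use p0 v B0 in auto)
    finally have num: "frechet_derivative (\<lambda>x. frechet_derivative \<rho> (at x) v) (at p) v > 0" .
    have "bounded_linear (frechet_derivative \<rho> (at p))"
      unfolding deriv using has_derivative_bounded_linear[OF has_derivative_quartic(1)[OF B]] .
    then have "0 < onorm (frechet_derivative \<rho> (at p))"
      using onorm_pos_lt deriv ne[OF p0] by metis
    then show "0 < normal_curvature \<rho> p v"
      using num v by (simp add: normal_curvature_def)
  qed
  ultimately show ?thesis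
    by (simp add: strongly_convex_nbhds_def strongly_convex_def)
qed

text \<open>
  The exhaustion is \<open>1 / (1 - q)\<close>, which is convex because \<open>q\<close> is. A convex function has the mean value inequality on
  circles, as one sees by averaging over pairs of opposite points \<open>a \<plusminus> cis \<theta> *s b\<close>.
\<close>

lemma pseudoconvex_convex_sublevel:
  fixes q :: "complex ^ 'n \<Rightarrow> real"
  assumes cont: "continuous_on UNIV q" and conv: "convex_on UNIV q" and bdd: "bounded {x. q x < 1}"
  shows "pseudoconvex {x. q x < 1}"
proof -
  let ?\<Omega> = "{x. q x < 1}"
  define u where "u = (\<lambda>x. 1 / (1 - q x))"
  have contu: "continuous_on ?\<Omega> u"
    unfolding u_def using continuous_on_subset[OF cont] by (intro continuous_intros) auto
  have mid: "u a \<le> 1/2 * (u (a + w) + u (a - w))" if "a + w \<in> ?\<Omega>" "a - w \<in> ?\<Omega>" for a w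
  proof -
    have "a = (1/2) *\<^sub>R (a + w) + (1/2) *\<^sub>R (a - w)"
      by (simp add: algebra_simps flip: scaleR_add_left)
    then have "q a \<le> 1/2 * q (a + w) + 1/2 * q (a - w)"
      using conv unfolding convex_on_def by (metis UNIV_I field_sum_of_halves half_gt_zero_iff less_imp_le zero_less_one)
    then have le: "((1 - q (a + w)) + (1 - q (a - w))) / 2 \<le> 1 - q a" by simp
    define s t where "s = 1 - q (a + w)" and "t = 1 - q (a - w)"
    have st: "s > 0" "t > 0" using that by (auto simp: s_def t_def)
    have "u a \<le> 1 / ((s + t) / 2)"
      unfolding u_def using le st by (intro divide_left_mono) (auto simp: s_def t_def intro!: mult_pos_pos)
    also have "\<dots> \<le> 1/2 * (1 / s + 1 / t)"
    proof -
      have "4 * (s * t) \<le> (s + t) * (s + t)"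
        using zero_le_power2[of "s - t"] by (simp add: power2_eq_square algebra_simps)
      then show ?thesis using st by (simp add: field_simps)
    qed
    finally show ?thesis by (simp add: u_def s_def t_def)
  qed
  have "u a \<le> 1 / (2 * pi) * integral {0..2 * pi} (\<lambda>\<theta>. u (a + cis \<theta> *s b))"
    if ab: "\<And>\<zeta>. norm \<zeta> \<le> 1 \<Longrightarrow> a + \<zeta> *s b \<in> ?\<Omega>" for a b
  proof -
    let ?f = "\<lambda>\<theta>. u (a + cis \<theta> *s b)"
    have contf: "continuous_on S ?f" for S
    proof (rule continuous_on_compose2[OF contu])
      have "(\<lambda>\<theta>. a + cis \<theta> *s b) = (\<lambda>\<theta>. \<chi> k. a $ k + cis \<theta> * b $ k)"
        by (simp add: vec_eq_iff fun_eq_iff)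
      then show "continuous_on S (\<lambda>\<theta>. a + cis \<theta> *s b)"
        by (simp only:) (intro continuous_on_vec_lambda continuous_intros)
      show "(\<lambda>\<theta>. a + cis \<theta> *s b) ` S \<subseteq> ?\<Omega>"
        using ab[OF eq_refl[OF norm_cis]] by blast
    qed
    have contf': "continuous_on S (\<lambda>\<theta>. ?f (\<theta> + pi))" for S
      by (rule continuous_on_compose2[OF contf[of UNIV]]) (auto intro: continuous_on_add continuous_on_id continuous_on_const)
    have i: "?f integrable_on {x..y}" for x y
      by (rule integrable_continuous_real[OF contf])
    have "integral {0..2 * pi} ?f = integral {0..pi} ?f + integral {pi..2 * pi} ?f"
      by (rule Henstock_Kurzweil_Integration.integral_combine[symmetric]) (auto intro: i)
    also have "integral {pi..2 * pi} ?f = integral {0..pi} (\<lambda>\<theta>. ?f (\<theta> + pi))"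
      using integral_shift[of 0 pi pi ?f] contf by (simp add: o_def)
    also have "integral {0..pi} ?f + \<dots> = integral {0..pi} (\<lambda>\<theta>. ?f \<theta> + ?f (\<theta> + pi))"
      by (intro Henstock_Kurzweil_Integration.integral_add[symmetric] i integrable_continuous_real contf')
    also have "\<dots> \<ge> integral {0..pi} (\<lambda>\<theta>. 2 * u a)"
    proof (rule integral_le)
      show "(\<lambda>\<theta>. ?f \<theta> + ?f (\<theta> + pi)) integrable_on {0..pi}"
        by (intro integrable_add i integrable_continuous_real contf')
      fix \<theta> :: real
      have "cis (\<theta> + pi) *s b = - (cis \<theta> *s b)"
        by (simp add: cis_mult[symmetric] vec_eq_iff)
      then show "2 * u a \<le> ?f \<theta> + ?f (\<theta> + pi)"
        using mid[of a "cis \<theta> *s b"] ab[of "cis \<theta>"] ab[of "- cis \<theta>"] by simp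
    qed (rule integrable_continuous_real[OF continuous_on_const])
    finally show ?thesis
      by (simp add: field_simps)
  qed
  then have "continuous_psh_on ?\<Omega> u"
    using contu by (auto simp: continuous_psh_on_def)
  moreover have "compact {z \<in> ?\<Omega>. u z \<le> c}" for c
  proof -
    have "{z \<in> ?\<Omega>. u z \<le> c} = (if c > 0 then {z. q z \<le> 1 - 1 / c} else {})"
    proof (cases "c > 0")
      case True
      have "q z < 1 \<and> 1 / (1 - q z) \<le> c \<longleftrightarrow> q z \<le> 1 - 1 / c" for z
      proof
        assume "q z < 1 \<and> 1 / (1 - q z) \<le> c"
        then show "q z \<le> 1 - 1 / c"
          using True pos_divide_le_eq[of "1 - q z" 1 c] pos_divide_le_eq[of c 1 "1 - q z"] by (simp add: mult.commute)
      next
        assume h: "q z \<le> 1 - 1 / c"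
        moreover have "1 / c > 0" using True by simp
        ultimately have "q z < 1" by linarith
        then show "q z < 1 \<and> 1 / (1 - q z) \<le> c"
          using True h pos_divide_le_eq[of "1 - q z" 1 c] pos_divide_le_eq[of c 1 "1 - q z"] by (simp add: mult.commute)
      qed
      then show ?thesis using True by (auto simp: u_def)
    next
      case False
      have "u z > 0" if "q z < 1" for z using that by (simp add: u_def)
      then show ?thesis using False by (force simp: not_less)
    qed
    moreover have "closed {z. q z \<le> 1 - 1 / c}"
      by (rule closed_Collect_le[OF cont continuous_on_const])
    moreover have "bounded {z. q z \<le> 1 - 1 / c}" if "c > 0"
      by (rule bounded_subset[OF bdd]) (use that in \<open>auto intro: le_less_trans\<close>)
    ultimately show ?thesis by (simp add: compact_eq_bounded_closed)
  qed
  moreover have "open ?\<Omega>" by (rule open_Collect_less[OF cont continuous_on_const])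
  ultimately show ?thesis by (auto simp: pseudoconvex_def)
qed

section \<open>Sums of squares from the Fock space\<close>

text \<open>
  The series of products of powers of \<open>k\<close> and \<open>k - 1\<close> that arise from the products of \<open>s\<^sup>k\<close> and its first two
  derivatives.
  Shifting the index by one cancels a factor \<open>k\<close> against the factorial, which expresses each series by
  previous ones. The truncated exponents \<open>k - 1\<close> and \<open>k - 2\<close> are harmless, since the coefficients of the terms
  concerned vanish.
\<close>

lemma exp_series_weighted:
  fixes r :: real
  shows "(\<lambda>k. r ^ k / fact k) sums exp r"
    and "(\<lambda>k. (real k)\<^sup>2 * r ^ (k - 1) / fact k) sums ((1 + r) * exp r)"
    and "(\<lambda>k. (real k)\<^sup>2 * (real k - 1)\<^sup>2 * r ^ (k - 2) / fact k) sums ((2 + 4 * r + r\<^sup>2) * exp r)"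
    and "(\<lambda>k. real k * r ^ (k - 1) / fact k) sums exp r"
    and "(\<lambda>k. real k * (real k - 1) * r ^ (k - 2) / fact k) sums exp r"
    and "(\<lambda>k. (real k)\<^sup>2 * (real k - 1) * r ^ (k - 2) / fact k) sums ((2 + r) * exp r)"
proof -
  let ?T0 = "\<lambda>k. r ^ k / fact k" and ?T1 = "\<lambda>k. (real k)\<^sup>2 * r ^ (k - 1) / fact k"
    and ?T2 = "\<lambda>k. (real k)\<^sup>2 * (real k - 1)\<^sup>2 * r ^ (k - 2) / fact k"
    and ?T3 = "\<lambda>k. real k * r ^ (k - 1) / fact k"
    and ?T4 = "\<lambda>k. real k * (real k - 1) * r ^ (k - 2) / fact k"
    and ?T5 = "\<lambda>k. (real k)\<^sup>2 * (real k - 1) * r ^ (k - 2) / fact k"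
  have shift: "f sums s" if "f 0 = 0" "\<And>k. f (Suc k) = g k" "g sums s" for f g :: "nat \<Rightarrow> real" and s
    using that sums_Suc_iff[of f s] by simp
  have pow: "real k * r ^ k = r * (real k * r ^ (k - 1))" for k
    by (cases k) auto
  have fS: "real (Suc k) * a / fact (Suc k) = a / fact k" for a k
    unfolding fact_Suc of_nat_mult using of_nat_neq_0[of k, where 'a = real] by (simp del: of_nat_Suc)
  show T0: "?T0 sums exp r"
    using exp_converges[of r] by (simp add: field_simps)
  show T3: "?T3 sums exp r"
    by (rule shift[OF _ _ T0]) (simp_all add: fS del: of_nat_Suc fact_Suc)
  show T1: "?T1 sums ((1 + r) * exp r)"
  proof (rule shift)
    show "(\<lambda>k. ?T0 k + r * ?T3 k) sums ((1 + r) * exp r)"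
      using sums_add[OF T0 sums_mult[OF T3, of r]] by (simp add: algebra_simps)
    fix k
    have "?T1 (Suc k) = real (Suc k) * (real (Suc k) * r ^ k) / fact (Suc k)"
      by (simp only: power2_eq_square diff_Suc_1 mult.assoc)
    also have "\<dots> = ?T0 k + r * ?T3 k"
      unfolding fS using pow[of k] by (simp add: field_simps)
    finally show "?T1 (Suc k) = ?T0 k + r * ?T3 k" .
  qed simp
  show T4: "?T4 sums exp r"
  proof (rule shift[OF _ _ T3])
    fix k
    have "?T4 (Suc k) = real (Suc k) * (real k * r ^ (k - 1)) / fact (Suc k)"
      by (simp add: mult.assoc del: fact_Suc)
    then show "?T4 (Suc k) = ?T3 k" unfolding fS .
  qed simp
  show T5: "?T5 sums ((2 + r) * exp r)"
  proof (rule shift)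
    show "(\<lambda>k. ?T1 k + ?T3 k) sums ((2 + r) * exp r)"
      using sums_add[OF T1 T3] by (simp add: algebra_simps)
    fix k
    have "?T5 (Suc k) = real (Suc k) * (real (Suc k) * real k * r ^ (k - 1)) / fact (Suc k)"
      by (simp add: power2_eq_square mult_ac del: fact_Suc)
    then show "?T5 (Suc k) = ?T1 k + ?T3 k"
      unfolding fS by (simp add: power2_eq_square algebra_simps add_divide_distrib)
  qed simp
  show "?T2 sums ((2 + 4 * r + r\<^sup>2) * exp r)"
  proof (rule shift)
    show "(\<lambda>k. r * ?T5 k + 2 * ?T1 k) sums ((2 + 4 * r + r\<^sup>2) * exp r)"
      using sums_add[OF sums_mult[OF T5, of r] sums_mult[OF T1, of 2]]
      by (simp add: algebra_simps power2_eq_square)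
    fix k
    have "?T2 (Suc k) = real (Suc k) * (real (Suc k) * (real k)\<^sup>2 * r ^ (k - 1)) / fact (Suc k)"
      by (simp add: power2_eq_square mult_ac del: fact_Suc)
    also have "\<dots> = (real (Suc k) * (real k)\<^sup>2 * r ^ (k - 1)) / fact k" by (rule fS)
    also have "real (Suc k) * (real k)\<^sup>2 * r ^ (k - 1) =
        r * ((real k)\<^sup>2 * (real k - 1) * r ^ (k - 2)) + 2 * ((real k)\<^sup>2 * r ^ (k - 1))"
    proof (cases k)
      case (Suc n)
      then show ?thesis by (cases n) (simp_all add: power2_eq_square algebra_simps)
    qed simp
    finally show "?T2 (Suc k) = r * ?T5 k + 2 * ?T1 k"
      by (simp add: add_divide_distrib)
  qed simp
qed

text \<open>
  The \<open>k\<close>-th summand is the square of \<open>(c + b \<partial> + a \<partial>\<^sup>2) s\<^sup>k\<close>, divided by \<open>k!\<close>. The functions \<open>s\<^sup>k / sqrt k!\<close> form an orthonormal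
  basis of the Fock space, so the sum is the squared norm of the differential operator applied to the
  reproducing kernel at \<open>s\<close>.
\<close>

lemma fock_norm_sums:
  fixes a b c s :: complex
  defines "r \<equiv> (norm s)\<^sup>2"
  shows "(\<lambda>k. (norm (c * s ^ k + b * of_nat k * s ^ (k - 1) + a * (of_nat k * (of_nat k - 1)) * s ^ (k - 2)))\<^sup>2 / fact k)
     sums (exp r * ((norm c)\<^sup>2 + (norm b)\<^sup>2 * (1 + r) + (norm a)\<^sup>2 * (2 + 4 * r + r\<^sup>2)
        + 2 * Re (c * cnj b * s + c * cnj a * s\<^sup>2 + b * cnj a * s * (2 + of_real r))))"
proof -
  have expand: "(norm (C + B + A))\<^sup>2 = (norm C)\<^sup>2 + (norm B)\<^sup>2 + (norm A)\<^sup>2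
      + 2 * (Re (C * cnj B) + Re (C * cnj A) + Re (B * cnj A))" for A B C :: complex
    unfolding cmod_power2 by (simp add: power2_eq_square algebra_simps)
  have ss: "s ^ n * cnj (s ^ n) = of_real (r ^ n)" for n
    using complex_norm_square[of "s ^ n"] by (simp add: r_def norm_power power_mult[symmetric] mult.commute)
  have s1: "of_nat k * (s ^ k * cnj (s ^ (k - 1))) = s * of_real (real k * r ^ (k - 1))" for k
  proof (cases k)
    case (Suc n)
    then show ?thesis using ss[of n] by (simp add: mult_ac del: complex_cnj_power)
  qed simp
  have s2: "of_nat k * (of_nat k - 1) * (s ^ k * cnj (s ^ (k - 2))) = s\<^sup>2 * of_real (real k * (real k - 1) * r ^ (k - 2))" for k
  proof -
    consider "k = 0" | "k = 1" | n where "k = n + 2" by (metis One_nat_def add_2_eq_Suc' not0_implies_Suc)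
    then show ?thesis
    proof cases
      case 3
      have "s ^ (n + 2) * cnj (s ^ n) = s\<^sup>2 * of_real (r ^ n)"
        using ss[of n] by (simp add: power_add power2_eq_square mult_ac del: complex_cnj_power)
      then show ?thesis using 3 by simp
    qed auto
  qed
  have s3: "(of_nat k)\<^sup>2 * (of_nat k - 1) * (s ^ (k - 1) * cnj (s ^ (k - 2))) = s * of_real ((real k)\<^sup>2 * (real k - 1) * r ^ (k - 2))" for k
  proof -
    consider "k = 0" | "k = 1" | n where "k = n + 2" by (metis One_nat_def add_2_eq_Suc' not0_implies_Suc)
    then show ?thesis
    proof cases
      case 3
      have "s ^ (n + 1) * cnj (s ^ n) = s * of_real (r ^ n)"
        using ss[of n] by (simp add: mult_ac del: complex_cnj_power)
      then show ?thesis using 3 by simp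
    qed auto
  qed
  have "(norm (c * s ^ k + b * of_nat k * s ^ (k - 1) + a * (of_nat k * (of_nat k - 1)) * s ^ (k - 2)))\<^sup>2 / fact k =
     (norm c)\<^sup>2 * (r ^ k / fact k) + (norm b)\<^sup>2 * ((real k)\<^sup>2 * r ^ (k - 1) / fact k) +
     (norm a)\<^sup>2 * ((real k)\<^sup>2 * (real k - 1)\<^sup>2 * r ^ (k - 2) / fact k) +
     2 * Re (c * cnj b * s) * (real k * r ^ (k - 1) / fact k) +
     2 * Re (c * cnj a * s\<^sup>2) * (real k * (real k - 1) * r ^ (k - 2) / fact k) +
     2 * Re (b * cnj a * s) * ((real k)\<^sup>2 * (real k - 1) * r ^ (k - 2) / fact k)" for k
  proof -
    let ?C = "c * s ^ k" and ?B = "b * of_nat k * s ^ (k - 1)" and ?A = "a * (of_nat k * (of_nat k - 1)) * s ^ (k - 2)"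
    have rp: "(norm (s ^ m))\<^sup>2 = r ^ m" for m
      by (simp add: r_def norm_power power_mult[symmetric] mult.commute)
    have n1: "norm (of_nat k - 1 :: complex) = \<bar>real k - 1\<bar>"
      by (metis norm_of_real of_real_1 of_real_diff of_real_of_nat_eq)
    have "(norm ?C)\<^sup>2 = (norm c)\<^sup>2 * r ^ k" "(norm ?B)\<^sup>2 = (norm b)\<^sup>2 * ((real k)\<^sup>2 * r ^ (k - 1))"
      "(norm ?A)\<^sup>2 = (norm a)\<^sup>2 * ((real k)\<^sup>2 * (real k - 1)\<^sup>2 * r ^ (k - 2))"
      by (simp_all add: norm_mult power_mult_distrib rp n1 del: norm_power)
    note n = this
    have c1: "?C * cnj ?B = of_real (real k * r ^ (k - 1)) * (c * cnj b * s)"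
      using s1[of k] by (simp add: mult_ac del: complex_cnj_power)
    have c2: "?C * cnj ?A = of_real (real k * (real k - 1) * r ^ (k - 2)) * (c * cnj a * s\<^sup>2)"
      using s2[of k] by (simp add: mult_ac del: complex_cnj_power)
    have c3: "?B * cnj ?A = of_real ((real k)\<^sup>2 * (real k - 1) * r ^ (k - 2)) * (b * cnj a * s)"
      using s3[of k] by (simp add: mult_ac power2_eq_square del: complex_cnj_power)
    have re: "Re (of_real t * w) = t * Re w" for t w by simp
    have "(x1 * y1 + x2 * y2 + x3 * y3 + 2 * (y4 * x4 + y5 * x5 + y6 * x6)) / f =
        x1 * (y1 / f) + x2 * (y2 / f) + x3 * (y3 / f) + 2 * x4 * (y4 / f) + 2 * x5 * (y5 / f) + 2 * x6 * (y6 / f)"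
      for x1 x2 x3 x4 x5 x6 y1 y2 y3 y4 y5 y6 f :: real
      by (simp add: add_divide_distrib algebra_simps)
    then show ?thesis
      unfolding expand n c1 c2 c3 re .
  qed
  moreover have "(\<lambda>k. (norm c)\<^sup>2 * (r ^ k / fact k) + (norm b)\<^sup>2 * ((real k)\<^sup>2 * r ^ (k - 1) / fact k) +
     (norm a)\<^sup>2 * ((real k)\<^sup>2 * (real k - 1)\<^sup>2 * r ^ (k - 2) / fact k) +
     2 * Re (c * cnj b * s) * (real k * r ^ (k - 1) / fact k) +
     2 * Re (c * cnj a * s\<^sup>2) * (real k * (real k - 1) * r ^ (k - 2) / fact k) +
     2 * Re (b * cnj a * s) * ((real k)\<^sup>2 * (real k - 1) * r ^ (k - 2) / fact k)) sums
     ((norm c)\<^sup>2 * exp r + (norm b)\<^sup>2 * ((1 + r) * exp r) + (norm a)\<^sup>2 * ((2 + 4 * r + r\<^sup>2) * exp r) +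
      2 * Re (c * cnj b * s) * exp r + 2 * Re (c * cnj a * s\<^sup>2) * exp r + 2 * Re (b * cnj a * s) * ((2 + r) * exp r))"
    by (intro sums_add sums_mult exp_series_weighted)
  moreover have "(norm c)\<^sup>2 * exp r + (norm b)\<^sup>2 * ((1 + r) * exp r) + (norm a)\<^sup>2 * ((2 + 4 * r + r\<^sup>2) * exp r) +
      2 * Re (c * cnj b * s) * exp r + 2 * Re (c * cnj a * s\<^sup>2) * exp r + 2 * Re (b * cnj a * s) * ((2 + r) * exp r) =
    exp r * ((norm c)\<^sup>2 + (norm b)\<^sup>2 * (1 + r) + (norm a)\<^sup>2 * (2 + 4 * r + r\<^sup>2)
        + 2 * Re (c * cnj b * s + c * cnj a * s\<^sup>2 + b * cnj a * s * (2 + of_real r)))"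
    by (simp add: algebra_simps)
  ultimately show ?thesis by simp
qed

lemma reproducible_fock:
  assumes "separately_holomorphic_on UNIV a" "separately_holomorphic_on UNIV b" "separately_holomorphic_on UNIV c"
  shows "reproducible (\<lambda>p. exp ((norm (fst p))\<^sup>2) * ((norm (c p))\<^sup>2 + (norm (b p))\<^sup>2 * (1 + (norm (fst p))\<^sup>2)
      + (norm (a p))\<^sup>2 * (2 + 4 * (norm (fst p))\<^sup>2 + ((norm (fst p))\<^sup>2)\<^sup>2)
      + 2 * Re (c p * cnj (b p) * fst p + c p * cnj (a p) * (fst p)\<^sup>2
          + b p * cnj (a p) * fst p * (2 + of_real ((norm (fst p))\<^sup>2)))))"
proof (rule reproducible_sums)
  let ?V = "\<lambda>k p. of_real (1 / sqrt (fact k)) * (c p * fst p ^ k + b p * of_nat k * fst p ^ (k - 1)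
      + a p * (of_nat k * (of_nat k - 1)) * fst p ^ (k - 2))"
  show "separately_holomorphic_on UNIV (?V k)" for k
    by (intro separately_holomorphic_intros assms)
  have "(norm (of_real (1 / sqrt (fact k)) * w))\<^sup>2 = (norm w)\<^sup>2 / fact k" for k and w :: complex
    by (simp add: norm_mult power_mult_distrib power_divide norm_divide)
  then show "(\<lambda>k. (norm (?V k p))\<^sup>2) sums (exp ((norm (fst p))\<^sup>2) * ((norm (c p))\<^sup>2 + (norm (b p))\<^sup>2 * (1 + (norm (fst p))\<^sup>2)
      + (norm (a p))\<^sup>2 * (2 + 4 * (norm (fst p))\<^sup>2 + ((norm (fst p))\<^sup>2)\<^sup>2)
      + 2 * Re (c p * cnj (b p) * fst p + c p * cnj (a p) * (fst p)\<^sup>2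
          + b p * cnj (a p) * fst p * (2 + of_real ((norm (fst p))\<^sup>2)))))" for p
    using fock_norm_sums[of "c p" "fst p" "b p" "a p"] by simp
qed

text \<open>
  The operator \<open>Y + 3/4 X \<partial>\<close>, that is, \<open>c = Y\<close>, \<open>b = 3/4 X\<close> and \<open>a = 0\<close> in the previous lemma. The last summand is the
  contribution of the commutator of \<open>\<partial>\<close> and multiplication by \<open>s\<close>.
\<close>

lemma fock_identity_1:
  fixes X Y s :: complex
  shows "(norm Y)\<^sup>2 + (norm (3/4 * X))\<^sup>2 * (1 + (norm s)\<^sup>2) + 2 * Re (Y * cnj (3/4 * X) * s)
    = (norm (Y + 3/4 * cnj s * X))\<^sup>2 + 9/16 * (norm X)\<^sup>2"
  unfolding cmod_power2 by (simp add: power2_eq_square field_simps)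

text \<open>
  The operator \<open>(Y + 3/4 X \<partial>)\<^sup>2 = Y\<^sup>2 + 3/2 X Y \<partial> + 9/16 X\<^sup>2 \<partial>\<^sup>2\<close>. With \<open>\<mu> = 3/4\<close> the coefficients on the right are \<open>4 \<mu>\<^sup>2\<close> and
  \<open>2 \<mu>\<^sup>4\<close>.
\<close>

lemma fock_identity_2:
  fixes X Y s :: complex
  defines "r \<equiv> (norm s)\<^sup>2" and "z \<equiv> Y + 3/4 * cnj s * X" and "b \<equiv> 3/2 * X * Y" and "a \<equiv> 9/16 * X\<^sup>2"
  shows "(norm (Y\<^sup>2))\<^sup>2 + (norm b)\<^sup>2 * (1 + r) + (norm a)\<^sup>2 * (2 + 4 * r + r\<^sup>2)
      + 2 * Re (Y\<^sup>2 * cnj b * s + Y\<^sup>2 * cnj a * s\<^sup>2 + b * cnj a * s * (2 + of_real r))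
    = (norm z) ^ 4 + 9/4 * (norm z)\<^sup>2 * (norm X)\<^sup>2 + 81/128 * (norm X) ^ 4"
proof -
  have n2: "of_real ((norm w)\<^sup>2) = w * cnj w" for w :: complex
    by (rule complex_norm_square)
  have n4: "of_real ((norm w) ^ 4) = (w * cnj w)\<^sup>2" for w :: complex
    using arg_cong[OF n2[of w], of "\<lambda>x. x\<^sup>2"] by simp
  have re: "complex_of_real (2 * Re w) = w + cnj w" for w
    by (rule complex_add_cnj[symmetric])
  have r: "complex_of_real r = s * cnj s"
    unfolding r_def by (rule n2)
  have "complex_of_real ((norm (Y\<^sup>2))\<^sup>2 + (norm b)\<^sup>2 * (1 + r) + (norm a)\<^sup>2 * (2 + 4 * r + r\<^sup>2)
      + 2 * Re (Y\<^sup>2 * cnj b * s + Y\<^sup>2 * cnj a * s\<^sup>2 + b * cnj a * s * (2 + of_real r)))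
    = complex_of_real ((norm z) ^ 4 + 9/4 * (norm z)\<^sup>2 * (norm X)\<^sup>2 + 81/128 * (norm X) ^ 4)"
    unfolding of_real_add re n4 of_real_mult[of "(norm _)\<^sup>2"] of_real_mult[of _ "(norm _)\<^sup>2"] of_real_mult[of _ "(norm _) ^ 4"] of_real_mult[of 4] of_real_power[of r] n2 r z_def b_def a_def
    by (simp add: r power2_eq_square field_simps)
  then show ?thesis by (simp only: of_real_eq_iff)
qed

section \<open>The twisted family of quartic bodies\<close>

definition shear :: "'n \<Rightarrow> 'n \<Rightarrow> complex \<Rightarrow> complex ^ 'n \<Rightarrow> complex ^ 'n" where
  "shear i j c x = (\<chi> k. if k = j then x $ j + c * x $ i else x $ k)"

text \<open>
  The map \<open>B\<^sub>s\<close> that takes the fiber over \<open>s\<close> back to the quartic body. It depends on \<open>s\<close> antiholomorphically up to the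
  positive factor, whose exponent \<open>1/4\<close> becomes \<open>1\<close> in a quartic and \<open>1/2\<close> in a hermitian form.
\<close>

definition untwist :: "'n \<Rightarrow> 'n \<Rightarrow> complex \<Rightarrow> complex ^ 'n \<Rightarrow> complex ^ 'n" where
  "untwist i j s x = of_real (exp ((norm s)\<^sup>2 / 4)) *s shear i j (3/4 * cnj s) x"

lemma GL_I:
  fixes A :: "complex ^ 'n \<Rightarrow> complex ^ 'n"
  assumes "\<And>x y. A (x + y) = A x + A y" "\<And>c x. A (c *s x) = c *s A x"
    and "\<And>x. A' (A x) = x" "\<And>x. A (A' x) = x"
  shows "A \<in> GL"
proof -
  have "Vector_Spaces.linear (*s) (*s) A"
    using assms(1,2) by (simp add: Vector_Spaces.linear_iff vec.vector_space_axioms)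
  moreover have "bij A"
    using assms(3,4) by (intro o_bij[of A']) (auto simp: fun_eq_iff)
  ultimately show ?thesis by (simp add: GL_def)
qed

lemma GL_linear: "A \<in> GL \<Longrightarrow> A (x + y) = A x + A y" "A \<in> GL \<Longrightarrow> A (c *s x) = c *s A x"
  by (simp_all add: GL_def Vector_Spaces.linear_iff)

lemma scaleR_eq_smult: "r *\<^sub>R (x :: complex ^ 'n) = of_real r *s x"
  by (simp add: vec_eq_iff scaleR_conv_of_real[where 'a = complex])

lemma norm_smult: "norm (c *s (x :: complex ^ 'n)) = norm c * norm x"
proof -
  have "(norm (c *s x))\<^sup>2 = (norm c * norm x)\<^sup>2"
    by (simp add: norm_vec_def L2_set_def real_sqrt_pow2 sum_nonneg norm_mult power_mult_distrib sum_distrib_left)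
  then show ?thesis by (simp add: power2_eq_iff_nonneg)
qed

lemma GL_imp_linear:
  assumes "A \<in> GL" shows "linear A"
  by (rule linearI) (simp_all add: scaleR_eq_smult GL_linear[OF assms])

lemma GL_inv:
  assumes "A \<in> GL" shows "inv A \<in> GL"
proof -
  have b: "bij A" using assms by (simp add: GL_def)
  have AI: "A (inv A x) = x" for x using b by (simp add: bij_is_surj surj_f_inv_f)
  have inj: "A x = A y \<longleftrightarrow> x = y" for x y using b by (simp add: bij_is_inj inj_eq)
  show ?thesis
  proof (rule GL_I[of _ A])
    show "inv A (x + y) = inv A x + inv A y" for x y
      using inj by (metis AI GL_linear(1)[OF assms])
    show "inv A (c *s x) = c *s inv A x" for c x
      using inj by (metis AI GL_linear(2)[OF assms])
  qed (use b in \<open>simp_all add: AI bij_is_inj\<close>)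
qed

lemma GL_image_eq:
  assumes "A \<in> GL" shows "A ` Y = {x. inv A x \<in> Y}"
  using assms by (simp add: GL_def bij_image_Collect_eq[of A "\<lambda>x. x \<in> Y", simplified])

lemma untwist_GL:
  assumes "i \<noteq> j"
  shows "untwist i j s \<in> GL"
proof (rule GL_I[of _ "\<lambda>x. of_real (exp (- ((norm s)\<^sup>2 / 4))) *s shear i j (- 3/4 * cnj s) x"])
  have e: "complex_of_real (exp (- ((norm s)\<^sup>2 / 4))) * complex_of_real (exp ((norm s)\<^sup>2 / 4)) = 1"
    "complex_of_real (exp ((norm s)\<^sup>2 / 4)) * complex_of_real (exp (- ((norm s)\<^sup>2 / 4))) = 1"
    by (simp_all flip: of_real_mult exp_add)
  have lin: "shear i j c (d *s x) = d *s shear i j c x" for c d x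
    by (simp add: shear_def vec_eq_iff algebra_simps)
  have inv: "shear i j (- c) (shear i j c x) = x" for c x
    using assms by (simp add: shear_def vec_eq_iff)
  show "of_real (exp (- ((norm s)\<^sup>2 / 4))) *s shear i j (- 3/4 * cnj s) (untwist i j s x) = x" for x
    using inv[of "3/4 * cnj s" x] by (simp add: untwist_def lin vector_smult_assoc e)
  show "untwist i j s (of_real (exp (- ((norm s)\<^sup>2 / 4))) *s shear i j (- 3/4 * cnj s) x) = x" for x
    using inv[of "- (3/4 * cnj s)" x] by (simp add: untwist_def lin vector_smult_assoc e)
  show "untwist i j s (x + y) = untwist i j s x + untwist i j s y" for x y
    by (simp add: untwist_def shear_def vec_eq_iff algebra_simps)
  show "untwist i j s (c *s x) = c *s untwist i j s x" for c x
    by (simp add: untwist_def shear_def vec_eq_iff algebra_simps)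
qed

lemma continuous_on_untwist: "continuous_on UNIV (\<lambda>q. untwist i j (fst q) (snd q))"
proof -
  have "continuous_on UNIV (\<lambda>q. shear i j (3/4 * cnj (fst q)) (snd q) $ k)" for k
    by (cases "k = j") (auto simp: shear_def intro!: continuous_intros)
  then have "continuous_on UNIV (\<lambda>q. \<chi> k. of_real (exp ((norm (fst q))\<^sup>2 / 4)) * shear i j (3/4 * cnj (fst q)) (snd q) $ k)"
    by (intro continuous_on_vec_lambda continuous_on_mult) (auto intro!: continuous_intros)
  moreover have "untwist i j (fst q) (snd q) = (\<chi> k. of_real (exp ((norm (fst q))\<^sup>2 / 4)) * shear i j (3/4 * cnj (fst q)) (snd q) $ k)" for q
    by (simp add: untwist_def vec_eq_iff)
  ultimately show ?thesis by simp
qed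

lemma continuous_on_quartic: "continuous_on S (quartic i j)"
  using has_derivative_quartic(1)[OF linear_id, of i j]
  by (auto intro!: continuous_at_imp_continuous_on has_derivative_continuous)

lemma quartic_smult: "quartic i j (of_real c *s y) = c ^ 4 * quartic i j y"
  by (simp add: quartic_def scaleR_eq_smult[symmetric] power2_eq_square power4_eq_xxxx algebra_simps)

lemma quartic_untwist_expand:
  fixes x :: "complex ^ 'n" and s :: complex
  assumes "i \<noteq> j"
  defines "K \<equiv> UNIV - {i, j}" and "z \<equiv> x $ j + 3/4 * cnj s * x $ i"
  shows "quartic i j (untwist i j s x) = exp ((norm s)\<^sup>2) *
    ((norm z) ^ 4 + (norm (x $ i)) ^ 4 + 9/4 * (norm z)\<^sup>2 * (norm (x $ i))\<^sup>2
     + 2 * (\<Sum>k\<in>K. (norm (x $ k))\<^sup>2) * ((norm (x $ i))\<^sup>2 + (norm z)\<^sup>2)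
     + (\<Sum>k\<in>K. (norm (x $ k))\<^sup>2)\<^sup>2)"
proof -
  let ?y = "shear i j (3/4 * cnj s) x"
  have "?y \<bullet> ?y = (\<Sum>k\<in>UNIV. (norm (?y $ k))\<^sup>2)"
    by (simp add: inner_vec_def power2_norm_eq_inner)
  also have "\<dots> = (norm (?y $ i))\<^sup>2 + (norm (?y $ j))\<^sup>2 + (\<Sum>k\<in>K. (norm (?y $ k))\<^sup>2)"
    using assms by (simp add: sum.remove[of UNIV i] sum.remove[of "UNIV - {i}" j] K_def Diff_insert2[symmetric] insert_commute)
  also have "(\<Sum>k\<in>K. (norm (?y $ k))\<^sup>2) = (\<Sum>k\<in>K. (norm (x $ k))\<^sup>2)"
    by (intro sum.cong refl) (auto simp: K_def shear_def)
  finally have yy: "?y \<bullet> ?y = (norm (x $ i))\<^sup>2 + (norm z)\<^sup>2 + (\<Sum>k\<in>K. (norm (x $ k))\<^sup>2)"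
    using assms(1) by (simp add: shear_def z_def)
  have "quartic i j (untwist i j s x) = exp ((norm s)\<^sup>2) * quartic i j ?y"
    by (simp add: untwist_def quartic_smult flip: exp_of_nat_mult)
  also have "quartic i j ?y = ((norm (x $ i))\<^sup>2 + (norm z)\<^sup>2 + (\<Sum>k\<in>K. (norm (x $ k))\<^sup>2))\<^sup>2
      + 1/4 * ((norm (x $ i))\<^sup>2 * (norm z)\<^sup>2)"
    unfolding quartic_def yy using assms(1) by (simp add: shear_def z_def power2_norm_eq_inner)
  finally show ?thesis
    by (simp add: power2_eq_square power4_eq_xxxx algebra_simps)
qed

text \<open>
  With \<open>z = x\<^sub>j + 3/4 cnj s x\<^sub>i\<close>, the quartic has the coefficient \<open>1\<close> at \<open>\<bar>x\<^sub>i\<bar>\<^sup>4\<close>, of which the Fock space identity uses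
  \<open>81/128\<close>, and the coefficient \<open>2\<close> at \<open>\<bar>x\<^sub>k\<bar>\<^sup>2 \<bar>x\<^sub>i\<bar>\<^sup>2\<close>, of which \<open>2 * 9/16\<close> is used together with \<open>2 \<bar>x\<^sub>k\<bar>\<^sup>2 \<bar>z\<bar>\<^sup>2\<close>. What remains,
  \<open>47/128\<close> and \<open>7/8\<close>, is positive, and \<open>exp (\<bar>s\<bar>\<^sup>2)\<close> times the square of a monomial in \<open>x\<close> is a sum of squares.
\<close>

lemma reproducible_quartic_untwist:
  fixes i j :: "'n::finite"
  assumes "i \<noteq> j"
  shows "reproducible (\<lambda>q. quartic i j (untwist i j (fst q) (snd q)))"
proof -
  define K where "K = UNIV - {i, j}"
  let ?E = "\<lambda>q :: complex \<times> (complex ^ 'n). exp ((norm (fst q))\<^sup>2)"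
  let ?z = "\<lambda>q :: complex \<times> (complex ^ 'n). snd q $ j + 3/4 * cnj (fst q) * snd q $ i"
  have E: "reproducible ?E"
    using reproducible_fock[OF separately_holomorphic_on_const[of _ 0] separately_holomorphic_on_const[of _ 0]
        separately_holomorphic_on_const[of _ 1]] by simp
  have L: "reproducible (\<lambda>q. ?E q * ((norm (?z q))\<^sup>2 + 9/16 * (norm (snd q $ i))\<^sup>2))"
    using reproducible_fock[OF separately_holomorphic_on_const[of _ 0]
        separately_holomorphic_on_mult[OF separately_holomorphic_on_const[of _ "3/4"] separately_holomorphic_on_snd[of _ i]]
        separately_holomorphic_on_snd[of _ j]]
    unfolding fock_identity_1[symmetric] by simp
  have "separately_holomorphic_on UNIV (\<lambda>q::complex \<times> (complex ^ 'n). 9/16 * (snd q $ i)\<^sup>2)"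
     "separately_holomorphic_on UNIV (\<lambda>q::complex \<times> (complex ^ 'n). 3/2 * snd q $ i * snd q $ j)"
     "separately_holomorphic_on UNIV (\<lambda>q::complex \<times> (complex ^ 'n). (snd q $ j)\<^sup>2)"
    by (intro separately_holomorphic_intros)+
  from reproducible_fock[OF this]
  have Q: "reproducible (\<lambda>q. ?E q * ((norm (?z q)) ^ 4 + 9/4 * (norm (?z q))\<^sup>2 * (norm (snd q $ i))\<^sup>2
      + 81/128 * (norm (snd q $ i)) ^ 4))"
    unfolding fock_identity_2 .
  have hol: "separately_holomorphic_on UNIV (\<lambda>q::complex \<times> (complex ^ 'n). snd q $ k * snd q $ l)" for k l
    by (intro separately_holomorphic_intros)
  have 1: "reproducible (\<lambda>q. 47/128 * ((norm (snd q $ i * snd q $ i))\<^sup>2 * ?E q))"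
    by (intro reproducible_scale reproducible_mult_norm E hol) simp
  have 2: "reproducible (\<lambda>q. \<Sum>k\<in>K. 2 * ((norm (snd q $ k))\<^sup>2 * (?E q * ((norm (?z q))\<^sup>2 + 9/16 * (norm (snd q $ i))\<^sup>2)))
      + 7/8 * ((norm (snd q $ k * snd q $ i))\<^sup>2 * ?E q))"
    by (intro reproducible_sum reproducible_add reproducible_scale reproducible_mult_norm E L hol separately_holomorphic_on_snd)
      (auto simp: K_def)
  have 3: "reproducible (\<lambda>q. \<Sum>k\<in>K. \<Sum>l\<in>K. (norm (snd q $ k * snd q $ l))\<^sup>2 * ?E q)"
    by (intro reproducible_sum reproducible_mult_norm E hol) (auto simp: K_def)
  let ?N = "\<lambda>q. ?E q * ((norm (?z q)) ^ 4 + 9/4 * (norm (?z q))\<^sup>2 * (norm (snd q $ i))\<^sup>2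
      + 81/128 * (norm (snd q $ i)) ^ 4) + 47/128 * ((norm (snd q $ i * snd q $ i))\<^sup>2 * ?E q)
      + (\<Sum>k\<in>K. 2 * ((norm (snd q $ k))\<^sup>2 * (?E q * ((norm (?z q))\<^sup>2 + 9/16 * (norm (snd q $ i))\<^sup>2)))
      + 7/8 * ((norm (snd q $ k * snd q $ i))\<^sup>2 * ?E q))
      + (\<Sum>k\<in>K. \<Sum>l\<in>K. (norm (snd q $ k * snd q $ l))\<^sup>2 * ?E q)"
  have "?N q = quartic i j (untwist i j (fst q) (snd q))" for q
  proof -
    define S where "S = (\<Sum>k\<in>K. (norm (snd q $ k))\<^sup>2)"
    have s2: "(\<Sum>k\<in>K. 2 * ((norm (snd q $ k))\<^sup>2 * (?E q * ((norm (?z q))\<^sup>2 + 9/16 * (norm (snd q $ i))\<^sup>2)))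
      + 7/8 * ((norm (snd q $ k * snd q $ i))\<^sup>2 * ?E q)) =
      2 * S * (?E q * ((norm (?z q))\<^sup>2 + 9/16 * (norm (snd q $ i))\<^sup>2)) + 7/8 * S * (norm (snd q $ i))\<^sup>2 * ?E q"
      unfolding S_def sum_distrib_left sum_distrib_right sum.distrib[symmetric]
      by (intro sum.cong refl) (simp add: norm_mult power_mult_distrib)
    have s3: "(\<Sum>k\<in>K. \<Sum>l\<in>K. (norm (snd q $ k * snd q $ l))\<^sup>2 * ?E q) = S\<^sup>2 * ?E q"
      unfolding S_def power2_eq_square[of "sum _ _"] sum_product
      by (simp add: norm_mult power_mult_distrib sum_distrib_right)
    show ?thesis
      unfolding s2 s3 quartic_untwist_expand[OF assms] K_def[symmetric] S_def[symmetric]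
      by (simp add: norm_mult power_mult_distrib power2_eq_square power4_eq_xxxx field_simps)
  qed
  moreover have "reproducible ?N"
    by (intro reproducible_add Q 1 2 3)
  ultimately show ?thesis by simp
qed

lemma stein_manifold_quartic_family:
  assumes "i \<noteq> j"
  shows "stein_manifold (mfd_over {q. quartic i j (untwist i j (fst q) (snd q)) < 1})"
  by (rule stein_manifold_sublevel[OF reproducible_quartic_untwist[OF assms]])
    (rule continuous_on_compose2[OF continuous_on_quartic[of UNIV] continuous_on_untwist], simp)

section \<open>The ellipsoid attached to the quartic body\<close>

lemma norm_invariant_if_ball_invariant:
  fixes L f :: "complex ^ 'n \<Rightarrow> complex ^ 'n"
  assumes L: "linear L" and f: "linear f"
    and inv: "\<And>y. norm (L (f y)) < 1 \<longleftrightarrow> norm (L y) < 1"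
  shows "norm (L (f y)) = norm (L y)"
proof -
  have scale: "norm (L (f (t *\<^sub>R y))) = t * norm (L (f y))" "norm (L (t *\<^sub>R y)) = t * norm (L y)" if "t \<ge> 0" for t
    using that by (simp_all add: linear_scale[OF L] linear_scale[OF f])
  have "\<not> norm (L (f y)) < norm (L y)"
  proof
    assume less: "norm (L (f y)) < norm (L y)"
    then have pos: "norm (L y) > 0" using norm_ge_zero[of "L (f y)"] by linarith
    then show False
      using inv[of "(1 / norm (L y)) *\<^sub>R y"] scale[of "1 / norm (L y)"] less by simp
  qed
  moreover have "\<not> norm (L y) < norm (L (f y))"
  proof
    assume less: "norm (L y) < norm (L (f y))"
    then have pos: "norm (L (f y)) > 0" using norm_ge_zero[of "L y"] by linarith
    then show False
      using inv[of "(1 / norm (L (f y))) *\<^sub>R y"] scale[of "1 / norm (L (f y))"] less by simp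
  qed
  ultimately show ?thesis by linarith
qed

definition plane_point :: "'n \<Rightarrow> 'n \<Rightarrow> complex \<Rightarrow> complex \<Rightarrow> complex ^ 'n" where
  "plane_point i j a b = (\<chi> k. if k = i then a else if k = j then b else 0)"

definition quartic_body :: "'n \<Rightarrow> 'n \<Rightarrow> (complex ^ 'n) set" where
  "quartic_body i j = {y. quartic i j y < 1}"

lemma quartic_body_strongly_convex: "quartic_body i j \<in> strongly_convex_nbhds"
  using quartic_domain_strongly_convex[OF linear_id, of i j] by (simp add: quartic_body_def)

text \<open>
  The change of sign in coordinate \<open>i\<close> and the exchange of the coordinates \<open>i\<close> and \<open>j\<close> preserve the quartic body, hence its image
  under \<open>\<Psi>\<close>, hence the hermitian norm \<open>\<bar>L y\<bar>\<close>. By the parallelogram law the first symmetry removes the mixed terms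
  in the plane of these coordinates, and the second makes the two remaining coefficients equal.
\<close>

lemma equivariant_image_of_quartic_body:
  fixes \<Psi> :: "(complex ^ 'n) set \<Rightarrow> (complex ^ 'n) set"
  assumes ij: "i \<noteq> j"
    and maps: "\<And>Y. Y \<in> strongly_convex_nbhds \<Longrightarrow> \<Psi> Y \<in> hermitian_ellipsoids"
    and equivariant: "\<And>A Y. Y \<in> strongly_convex_nbhds \<Longrightarrow> A \<in> GL \<Longrightarrow> \<Psi> (A ` Y) = A ` \<Psi> Y"
  obtains L h where "L \<in> GL" "\<Psi> (quartic_body i j) = {y. norm (L y) < 1}" "h > 0"
    "\<And>a b. (norm (L (plane_point i j a b)))\<^sup>2 = h * ((norm a)\<^sup>2 + (norm b)\<^sup>2)"
proof -
  let ?Y = "quartic_body i j"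
  have Y: "?Y \<in> strongly_convex_nbhds" by (rule quartic_body_strongly_convex)
  obtain C where C: "C \<in> GL" "\<Psi> ?Y = C ` ball 0 1"
    using maps[OF Y] by (auto simp: hermitian_ellipsoids_def)
  define L where "L = inv C"
  have LGL: "L \<in> GL" unfolding L_def by (rule GL_inv[OF C(1)])
  have \<Psi>Y: "\<Psi> ?Y = {y. norm (L y) < 1}"
    unfolding C(2) GL_image_eq[OF C(1)] by (auto simp: L_def)
  have invariant: "norm (L (f y)) = norm (L y)"
    if f: "f \<in> GL" "\<And>y. f (f y) = y" "\<And>y. quartic i j (f y) = quartic i j y" for f y
  proof (rule norm_invariant_if_ball_invariant[OF GL_imp_linear[OF LGL] GL_imp_linear[OF f(1)]])
    have im: "f ` S = {y. f y \<in> S}" for S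
    proof (intro equalityI subsetI)
      fix y assume "y \<in> {y. f y \<in> S}"
      then show "y \<in> f ` S" by (intro image_eqI[of _ _ "f y"]) (simp_all add: f(2))
    qed (auto simp: f(2))
    have "f ` ?Y = ?Y" unfolding im by (simp add: quartic_body_def f(3))
    then have "f ` \<Psi> ?Y = \<Psi> ?Y" using equivariant[OF Y f(1)] by simp
    then have "{y. f y \<in> \<Psi> ?Y} = \<Psi> ?Y" unfolding im .
    then show "norm (L (f y)) < 1 \<longleftrightarrow> norm (L y) < 1" for y
      unfolding \<Psi>Y by (simp add: set_eq_iff)
  qed
  \<comment> \<open>The two symmetries are their own inverses.\<close>
  define sg where "sg = (\<lambda>y :: complex ^ 'n. \<chi> k. if k = i then - (y $ k) else y $ k)"
  define sw where "sw = (\<lambda>y :: complex ^ 'n. \<chi> k. y $ (if k = i then j else if k = j then i else k))"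
  have sum_sw: "(\<Sum>k\<in>UNIV. g (if k = i then j else if k = j then i else k)) = (\<Sum>k\<in>UNIV. g k)" for g :: "'n \<Rightarrow> real"
  proof (rule sum.reindex_bij_betw)
    show "bij (\<lambda>k. if k = i then j else if k = j then i else k)"
      by (rule o_bij[of "\<lambda>k. if k = i then j else if k = j then i else k"]) (auto simp: fun_eq_iff ij)
  qed
  have sg: "norm (L (sg y)) = norm (L y)" for y
  proof (rule invariant)
    show "sg \<in> GL" by (rule GL_I[of _ sg]) (simp_all add: sg_def vec_eq_iff)
    show "sg (sg y) = y" for y by (simp add: sg_def vec_eq_iff)
    have "sg y \<bullet> sg y = y \<bullet> y" for y
      unfolding inner_vec_def by (intro sum.cong refl) (simp add: sg_def)
    then show "quartic i j (sg y) = quartic i j y" for y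
      using ij by (simp add: quartic_def) (simp add: sg_def)
  qed
  have sw: "norm (L (sw y)) = norm (L y)" for y
  proof (rule invariant)
    show "sw \<in> GL" by (rule GL_I[of _ sw]) (use ij in \<open>auto simp: sw_def vec_eq_iff\<close>)
    show "sw (sw y) = y" for y using ij by (auto simp: sw_def vec_eq_iff)
    have "sw y \<bullet> sw y = y \<bullet> y" for y
      unfolding inner_vec_def using sum_sw[of "\<lambda>k. y $ k \<bullet> y $ k"] by (simp add: sw_def)
    then show "quartic i j (sw y) = quartic i j y" for y
      using ij by (simp add: quartic_def) (simp add: sw_def mult.commute)
  qed
  define e where "e = plane_point i j 1 0"
  define e' where "e' = plane_point i j 0 1"
  define h where "h = (norm (L e))\<^sup>2"
  have "sw e = e'" using ij by (simp add: sw_def e_def e'_def plane_point_def vec_eq_iff)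
  then have h': "(norm (L e'))\<^sup>2 = h" using sw[of e] by (simp add: h_def)
  have "L 0 = 0" using GL_imp_linear[OF LGL] by (rule linear_0)
  moreover have "inj L" using LGL by (simp add: GL_def bij_is_inj)
  moreover have "e \<noteq> 0" by (auto simp: e_def plane_point_def vec_eq_iff)
  ultimately have "L e \<noteq> 0" by (metis injD)
  then have "h > 0" by (simp add: h_def)
  moreover have "(norm (L (plane_point i j a b)))\<^sup>2 = h * ((norm a)\<^sup>2 + (norm b)\<^sup>2)" for a b
  proof -
    have p: "plane_point i j a b = a *s e + b *s e'"
      using ij by (simp add: e_def e'_def plane_point_def vec_eq_iff)
    have "sg (a *s e + b *s e') = (- a) *s e + b *s e'"
      using ij by (simp add: sg_def e_def e'_def plane_point_def vec_eq_iff)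
    then have flip: "norm (L ((- a) *s e + b *s e')) = norm (L (a *s e + b *s e'))"
      using sg[of "a *s e + b *s e'"] by (simp only:)
    have "L (c *s e + b *s e') = c *s L e + b *s L e'" for c
      by (simp add: GL_linear[OF LGL])
    moreover have "(- a) *s L e = - (a *s L e)"
      by (simp add: vec_eq_iff)
    ultimately have n: "norm (- (a *s L e) + b *s L e') = norm (a *s L e + b *s L e')"
      using flip by (simp only:)
    have "(norm (- p + q))\<^sup>2 + (norm (p + q))\<^sup>2 = 2 * ((norm p)\<^sup>2 + (norm q)\<^sup>2)" for p q :: "complex ^ 'n"
      by (simp add: power2_norm_eq_inner inner_simps)
    from this[of "a *s L e" "b *s L e'"]
    have "(norm (a *s L e + b *s L e'))\<^sup>2 = (norm (a *s L e))\<^sup>2 + (norm (b *s L e'))\<^sup>2"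
      unfolding n by simp
    then show ?thesis
      unfolding p by (simp add: GL_linear[OF LGL] norm_smult power_mult_distrib h' h_def[symmetric] algebra_simps)
  qed
  ultimately show thesis using that LGL \<Psi>Y by blast
qed

section \<open>Discs showing that the ellipsoids are not a Stein family\<close>

text \<open>
  The slope \<open>- 3/4 l\<close> minimizes the coefficient of \<open>\<bar>t\<bar>\<^sup>2\<close> in the hermitian norm along such a disc.
\<close>

definition disc_point :: "'n \<Rightarrow> 'n \<Rightarrow> complex \<Rightarrow> complex \<Rightarrow> complex \<times> (complex ^ 'n)" where
  "disc_point i j l t = (t, plane_point i j (- 3/4 * l * t) l)"

lemma untwist_disc_point:
  assumes "i \<noteq> j"
  shows "untwist i j t (plane_point i j (- 3/4 * l * t) l) =
    of_real (exp ((norm t)\<^sup>2 / 4)) *s plane_point i j (- 3/4 * l * t) (l * (1 - 9/16 * of_real ((norm t)\<^sup>2)))"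
proof -
  have "shear i j (3/4 * cnj t) (plane_point i j (- 3/4 * l * t) l) =
      plane_point i j (- 3/4 * l * t) (l * (1 - 9/16 * of_real ((norm t)\<^sup>2)))"
    unfolding shear_def plane_point_def complex_norm_square using assms by (simp add: vec_eq_iff algebra_simps)
  then show ?thesis by (simp add: untwist_def)
qed

text \<open>
  The hermitian norm, squared, along the disc with \<open>h l\<^sup>2 = 1\<close>, as a function of \<open>r = \<bar>t\<bar>\<^sup>2\<close>.
\<close>

definition disc_profile :: "real \<Rightarrow> real" where
  "disc_profile r = exp (r / 2) * (9/16 * r + (1 - 9/16 * r)\<^sup>2)"

text \<open>
  The linear coefficient of the expansion at \<open>0\<close> is \<open>1/2 - 9/16 = - 1/16\<close>, and for \<open>r \<le> 1/16\<close> the terms of higher order are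
  too small to compensate it.
\<close>

lemma disc_profile_less:
  assumes "0 < r" "r \<le> 1/16"
  shows "disc_profile r < 1"
proof -
  have "exp (r / 2) \<le> 1 + r / 2 + (r / 2)\<^sup>2"
    using assms by (intro exp_bound) auto
  moreover have "0 \<le> 9/16 * r + (1 - 9/16 * r)\<^sup>2" using assms by (intro add_nonneg_nonneg) auto
  ultimately have "disc_profile r \<le> (1 + r / 2 + (r / 2)\<^sup>2) * (9/16 * r + (1 - 9/16 * r)\<^sup>2)"
    unfolding disc_profile_def by (rule mult_right_mono)
  also have "\<dots> = 1 + r * (- 1/16 + 73/256 * r + 9/512 * r\<^sup>2 + 81/1024 * (r\<^sup>2 * r))"
    by (simp add: power2_eq_square field_simps)
  also have "\<dots> < 1"
  proof -
    have "r\<^sup>2 \<le> 1/16 * r" using assms by (simp add: power2_eq_square)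
    moreover have "r\<^sup>2 * r \<le> 1/16 * r\<^sup>2" using assms by (simp add: power2_eq_square mult_mono)
    ultimately have "- 1/16 + 73/256 * r + 9/512 * r\<^sup>2 + 81/1024 * (r\<^sup>2 * r) < 0" using assms by linarith
    then show ?thesis using assms(1) by (simp add: mult_pos_neg)
  qed
  finally show ?thesis .
qed

lemma separately_holomorphic_on_disc:
  fixes g :: "complex \<times> (complex ^ 'n) \<Rightarrow> complex"
  assumes W: "open W" and g: "separately_holomorphic_on W g" and "i \<noteq> j"
  shows "(\<lambda>t. g (disc_point i j l t)) holomorphic_on {t. disc_point i j l t \<in> W}"
proof -
  let ?P = "\<lambda>q :: complex \<times> complex. (fst q, plane_point i j (snd q) l)"
  have contP: "continuous_on S ?P" for S
  proof -
    have "continuous_on S (\<lambda>q. if k = i then snd q else if k = j then l else 0)" for k and S :: "(complex \<times> complex) set"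
      by (cases "k = i") (auto intro: continuous_intros)
    then show ?thesis
      unfolding plane_point_def by (intro continuous_on_Pair continuous_on_vec_lambda continuous_intros)
  qed
  define V where "V = {q. ?P q \<in> W}"
  have upd: "vec_upd (plane_point i j w l) i t = plane_point i j t l" for w t
    by (simp add: vec_upd_def plane_point_def vec_eq_iff)
  have nth: "plane_point i j w l $ i = w" for w by (simp add: plane_point_def)
  have "(\<lambda>t. (\<lambda>q. g (?P q)) (t, (- 3/4 * l) * t)) holomorphic_on {t. (t, (- 3/4 * l) * t) \<in> V}"
  proof (rule separately_holomorphic_imp_holomorphic_on_line)
    show "open V"
      using open_vimage[OF W contP] by (simp add: V_def vimage_def)
    show "continuous_on V (\<lambda>q. g (?P q))"
    proof (rule continuous_on_compose2[of W g])
      show "continuous_on W g" using g by (simp add: separately_holomorphic_on_def)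
    qed (auto simp: V_def contP)
    fix z w assume "(z, w) \<in> V"
    then have "(z, plane_point i j w l) \<in> W" by (simp add: V_def)
    then have 1: "(\<lambda>t. g (t, plane_point i j w l)) field_differentiable at z"
      and 2: "(\<lambda>t. g (z, vec_upd (plane_point i j w l) i t)) field_differentiable at (plane_point i j w l $ i)"
      using g unfolding separately_holomorphic_on_def by blast+
    show "(\<lambda>t. g (?P (t, w))) field_differentiable at z" using 1 by simp
    show "(\<lambda>t. g (?P (z, t))) field_differentiable at w" using 2 by (simp add: upd nth)
  qed
  then show ?thesis by (simp add: V_def disc_point_def)
qed

text \<open>
  The discs with parameter \<open>l < m\<close>, where \<open>h m\<^sup>2 = 1\<close>, lie in the domain, and their boundary circles stay in a compact
  subset \<open>K\<close> of it even for \<open>l = m\<close>. By the maximum principle their centers belong to the hull of \<open>K\<close>, but for \<open>l \<rightarrow> m\<close>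
  the centers converge to a boundary point.
\<close>

lemma not_stein_ellipsoid_family:
  fixes L :: "complex ^ 'n \<Rightarrow> complex ^ 'n"
  assumes ij: "i \<noteq> j" and L: "L \<in> GL" and h: "h > 0"
    and plane: "\<And>a b. (norm (L (plane_point i j a b)))\<^sup>2 = h * ((norm a)\<^sup>2 + (norm b)\<^sup>2)"
  shows "\<not> stein_manifold (mfd_over {q. norm (L (untwist i j (fst q) (snd q))) < 1})"
proof
  let ?W = "{q. norm (L (untwist i j (fst q) (snd q))) < 1}"
  have contL: "continuous_on UNIV L"
    using GL_imp_linear[OF L] by (simp add: linear_continuous_on linear_conv_bounded_linear)
  have "continuous_on UNIV (\<lambda>q. norm (L (untwist i j (fst q) (snd q))))"
    by (rule continuous_on_norm) (rule continuous_on_compose2[OF contL continuous_on_untwist], simp)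
  then have W: "open ?W" by (rule open_Collect_less[OF _ continuous_on_const])
  assume stein: "stein_manifold (mfd_over ?W)"
  define m where "m = 1 / sqrt h"
  have m: "m > 0" "h * m\<^sup>2 = 1" using h by (simp_all add: m_def power_divide)
  define d where "d = (\<lambda>(l::real) t. disc_point i j (of_real l) t)"
  have size: "(norm (L (untwist i j (fst (d l t)) (snd (d l t)))))\<^sup>2 = (h * l\<^sup>2) * disc_profile ((norm t)\<^sup>2)" for l t
  proof -
    have "norm (1 - 9/16 * complex_of_real ((norm t)\<^sup>2)) = \<bar>1 - 9/16 * (norm t)\<^sup>2\<bar>"
      using norm_of_real[of "1 - 9/16 * (norm t)\<^sup>2", where 'a = complex] by simp
    then have n: "(norm (complex_of_real l * (1 - 9/16 * complex_of_real ((norm t)\<^sup>2))))\<^sup>2 = l\<^sup>2 * (1 - 9/16 * (norm t)\<^sup>2)\<^sup>2"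
      by (simp only: norm_mult power_mult_distrib norm_of_real power2_abs)
    have n': "(norm (- 3/4 * complex_of_real l * t))\<^sup>2 = l\<^sup>2 * (9/16 * (norm t)\<^sup>2)"
      by (simp add: norm_mult power_mult_distrib power_divide)
    have e: "(norm (complex_of_real (exp ((norm t)\<^sup>2 / 4))))\<^sup>2 = exp ((norm t)\<^sup>2 / 2)"
      by (simp flip: exp_of_nat_mult)
    show ?thesis
      unfolding d_def disc_point_def fst_conv snd_conv untwist_disc_point[OF ij] GL_linear(2)[OF L] norm_smult
        power_mult_distrib[of "norm (complex_of_real (exp ((norm t)\<^sup>2 / 4)))"] plane n n' e disc_profile_def
      by (simp add: algebra_simps)
  qed
  have in_W: "d l t \<in> ?W" if "0 \<le> l" "norm t \<le> 1/4" "l < m \<or> l = m \<and> t \<noteq> 0" for l t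
  proof -
    have le: "h * l\<^sup>2 \<le> 1" and nn: "0 \<le> h * l\<^sup>2"
      using that m h power_mono[of l m 2] mult_left_mono[of "l\<^sup>2" "m\<^sup>2" h] by auto
    have r: "(norm t)\<^sup>2 \<le> 1/16" using power_mono[OF that(2), of 2] by (simp add: power2_eq_square)
    have "(h * l\<^sup>2) * disc_profile ((norm t)\<^sup>2) < 1"
    proof (cases "t = 0")
      case True
      then have "l < m" using that by auto
      then have "l\<^sup>2 < m\<^sup>2" using that by (intro power_strict_mono) auto
      then have "h * l\<^sup>2 < 1" using h m by (metis mult_strict_left_mono)
      then show ?thesis using True by (simp add: disc_profile_def)
    next
      case False
      then have p: "disc_profile ((norm t)\<^sup>2) < 1" using r by (intro disc_profile_less) auto
      have "0 \<le> disc_profile ((norm t)\<^sup>2)" by (simp add: disc_profile_def)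
      then have "(h * l\<^sup>2) * disc_profile ((norm t)\<^sup>2) \<le> 1 * disc_profile ((norm t)\<^sup>2)"
        using le by (intro mult_right_mono) auto
      then show ?thesis using p by simp
    qed
    then have "(norm (L (untwist i j (fst (d l t)) (snd (d l t)))))\<^sup>2 < 1\<^sup>2" by (simp add: size)
    then have "norm (L (untwist i j (fst (d l t)) (snd (d l t)))) < 1" by (rule power_less_imp_less_base) simp
    then show ?thesis by simp
  qed
  have contd: "continuous_on S (\<lambda>q. d (fst q) (snd q))" for S
  proof -
    have "continuous_on S (\<lambda>q :: real \<times> complex. if k = i then - 3/4 * complex_of_real (fst q) * snd q else if k = j then complex_of_real (fst q) else 0)" for k
      by (cases "k = i"; cases "k = j") (auto intro!: continuous_intros)
    then show ?thesis
      unfolding d_def disc_point_def plane_point_def by (intro continuous_on_Pair continuous_on_vec_lambda continuous_intros)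
  qed
  define K where "K = (\<lambda>q. d (fst q) (snd q)) ` ({0..m} \<times> sphere 0 (1/4))"
  have "compact K" unfolding K_def
    by (intro compact_continuous_image contd compact_Times) auto
  moreover have KW: "K \<subseteq> ?W"
  proof -
    have "d l t \<in> ?W" if "l \<in> {0..m}" "t \<in> sphere 0 (1/4)" for l t
      using that by (intro in_W) (auto simp: le_less)
    then show ?thesis unfolding K_def by (intro image_subsetI) (simp only: mem_Times_iff)
  qed
  moreover have "K \<noteq> {}"
  proof -
    have "d 0 (1/4) \<in> K"
      unfolding K_def using m(1) by (intro image_eqI[of _ _ "(0, 1/4)"]) auto
    then show ?thesis by blast
  qed
  ultimately have "compact (holo_hull_in ?W K)"
    using stein unfolding stein_manifold_mfd_over_iff[OF W] by blast
  then have closed: "closed (holo_hull_in ?W K)" by (rule compact_imp_closed)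
  have centre: "d l 0 \<in> holo_hull_in ?W K" if l: "0 \<le> l" "l < m" for l
  proof -
    have "norm (g (d l 0)) \<le> (SUP p\<in>K. norm (g p))" if g: "separately_holomorphic_on ?W g" for g
    proof -
      have "continuous_on K (\<lambda>p. norm (g p))"
        using g KW by (auto simp: separately_holomorphic_on_def intro!: continuous_on_norm intro: continuous_on_subset)
      then have bdd: "bdd_above ((\<lambda>p. norm (g p)) ` K)"
        using \<open>compact K\<close> by (intro bounded_imp_bdd_above compact_imp_bounded compact_continuous_image)
      have hol: "(\<lambda>t. g (d l t)) holomorphic_on cball 0 (1/4)"
        unfolding d_def
        by (rule holomorphic_on_subset[OF separately_holomorphic_on_disc[OF W g ij]])
          (use in_W l in \<open>auto simp: d_def\<close>)
      show ?thesis
      proof (rule maximum_modulus_frontier[where f = "\<lambda>t. g (d l t)" and S = "cball 0 (1/4)"])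
        show "(\<lambda>t. g (d l t)) holomorphic_on interior (cball 0 (1/4))"
          using hol by (rule holomorphic_on_subset) (rule interior_subset)
        show "continuous_on (closure (cball 0 (1/4))) (\<lambda>t. g (d l t))"
          using hol by (simp add: holomorphic_on_imp_continuous_on)
        fix t :: complex assume "t \<in> frontier (cball 0 (1/4))"
        then have "d l t \<in> K"
          unfolding K_def using l by (intro image_eqI[of _ _ "(l, t)"]) auto
        then show "norm (g (d l t)) \<le> (SUP p\<in>K. norm (g p))"
          by (rule cSUP_upper[OF _ bdd])
      qed auto
    qed
    moreover have "d l 0 \<in> ?W" using l by (intro in_W) auto
    ultimately show ?thesis unfolding holo_hull_in_def by blast
  qed
  have conv: "(\<lambda>n. d (m * (1 - 1 / real (Suc n))) 0) \<longlonglongrightarrow> d m 0"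
  proof -
    have "(\<lambda>n. m * (1 - 1 / real (Suc n))) \<longlonglongrightarrow> m * (1 - 0)"
      by (intro tendsto_intros LIMSEQ_Suc lim_1_over_n)
    then have "(\<lambda>n. (m * (1 - 1 / real (Suc n)), 0::complex)) \<longlonglongrightarrow> (m, 0)"
      by (intro tendsto_Pair tendsto_const) simp
    then have "(\<lambda>n. (\<lambda>q. d (fst q) (snd q)) (m * (1 - 1 / real (Suc n)), 0)) \<longlonglongrightarrow> (\<lambda>q. d (fst q) (snd q)) (m, 0)"
      by (rule continuous_on_tendsto_compose[OF contd[of UNIV]]) auto
    then show ?thesis by simp
  qed
  have mem: "d (m * (1 - 1 / real (Suc n))) 0 \<in> holo_hull_in ?W K" for n
    using m(1) by (intro centre) (auto simp: field_simps)
  have "d m 0 \<in> holo_hull_in ?W K"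
    by (rule closed_sequentially[OF closed _ conv]) (use mem in blast)
  then have "d m 0 \<in> ?W" by (simp add: holo_hull_in_def)
  then have "norm (L (untwist i j (fst (d m 0)) (snd (d m 0)))) < 1" by simp
  moreover have "(norm (L (untwist i j (fst (d m 0)) (snd (d m 0)))))\<^sup>2 = 1"
    unfolding size using m(2) by (simp add: disc_profile_def)
  ultimately show False
    using norm_ge_zero[of "L (untwist i j (fst (d m 0)) (snd (d m 0)))"] unfolding power2_eq_1_iff by linarith
qed

section \<open>Equivariant ellipsoids do not preserve pseudoconvexity\<close>

lemma fiber_over: "s \<in> extensional {0} \<Longrightarrow> fiber (over W) s = {x. (s 0, x) \<in> W}"
  by (simp add: fiber_def over_def to_model_def)

lemma points_complex_line: "points complex_line = extensional {0}"
  by (simp add: complex_line_def topspace_cspace)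

theorem theorem1p4:
  fixes \<Psi> :: "(complex ^ 'n) set \<Rightarrow> (complex ^ 'n) set"
  assumes dim: "CARD('n) \<ge> 2"
    and maps: "\<And>Y. Y \<in> strongly_convex_nbhds \<Longrightarrow> \<Psi> Y \<in> hermitian_ellipsoids"
    and equivariant: "\<And>A Y. Y \<in> strongly_convex_nbhds \<Longrightarrow> A \<in> GL \<Longrightarrow> \<Psi> (A ` Y) = A ` \<Psi> Y"
  shows "\<exists>(S :: (nat \<Rightarrow> complex, nat) cmfd) (X :: ((nat \<Rightarrow> complex) \<times> (complex ^ 'n)) set).
           complex_manifold S \<and>
           pseudoconvex_family S X \<and>
           (\<forall>s\<in>points S. fiber X s \<in> strongly_convex_nbhds) \<and>
           \<not> pseudoconvex_family S (\<Union>s\<in>points S. {s} \<times> \<Psi> (fiber X s))"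
proof -
  obtain i j :: 'n where ij: "i \<noteq> j"
    using dim by (metis One_nat_def Suc_1 card_2_iff' card_le_Suc0_iff_eq finite_class.finite_UNIV not_less_eq_eq UNIV_I)
  obtain L h where L: "L \<in> GL" "\<Psi> (quartic_body i j) = {y. norm (L y) < 1}" "h > 0"
    "\<And>a b. (norm (L (plane_point i j a b)))\<^sup>2 = h * ((norm a)\<^sup>2 + (norm b)\<^sup>2)"
    using equivariant_image_of_quartic_body[OF ij maps equivariant] by blast
  define W where "W = {q. quartic i j (untwist i j (fst q) (snd q)) < 1}"
  define W' where "W' = {q. norm (L (untwist i j (fst q) (snd q))) < 1}"
  have lin: "linear (untwist i j s)" "inj (untwist i j s)" for s
    using untwist_GL[OF ij, of s] GL_imp_linear by (auto simp: GL_def bij_is_inj)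
  have fib: "fiber (over W) s = {x. quartic i j (untwist i j (s 0) x) < 1}" if "s \<in> extensional {0}" for s
    using that by (simp add: fiber_over W_def)
  have nbhd: "fiber (over W) s \<in> strongly_convex_nbhds" if "s \<in> extensional {0}" for s
    unfolding fib[OF that] by (rule quartic_domain_strongly_convex[OF lin])
  have "continuous_on UNIV (\<lambda>q. quartic i j (untwist i j (fst q) (snd q)))"
    by (rule continuous_on_compose2[OF continuous_on_quartic[of UNIV] continuous_on_untwist]) simp
  then have W: "open W" unfolding W_def by (rule open_Collect_less[OF _ continuous_on_const])
  have "pseudoconvex (fiber (over W) s)" if s: "s \<in> extensional {0}" for s
    unfolding fib[OF s]
  proof (rule pseudoconvex_convex_sublevel)
    show "continuous_on UNIV (\<lambda>x. quartic i j (untwist i j (s 0) x))"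
      by (rule continuous_on_compose2[OF continuous_on_quartic[of UNIV]])
        (use lin(1) in \<open>auto simp: linear_continuous_on linear_conv_bounded_linear\<close>)
    show "bounded {x. quartic i j (untwist i j (s 0) x) < 1}"
      using nbhd[OF s] unfolding fib[OF s] by (simp add: strongly_convex_nbhds_def)
  qed (rule convex_on_quartic[OF lin(1)])
  moreover have "extensional {0} \<times> {0} \<subseteq> over W"
    using nbhd by (auto simp: strongly_convex_nbhds_def fiber_def)
  ultimately have fam: "family_of_pseudoconvex_sets complex_line (over W)"
    using openin_over[OF W] unfolding family_of_pseudoconvex_sets_def points_complex_line
    by (simp add: complex_line_def)
  moreover have "stein_manifold (mfd_over W)"
    unfolding W_def by (rule stein_manifold_quartic_family[OF ij])
  ultimately have X: "pseudoconvex_family complex_line (over W)"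
    by (simp add: pseudoconvex_family_def mfd_over_def)
  \<comment> \<open>The fiber over \<open>s\<close> is a linear image of the quartic body, so equivariance determines its ellipsoid.\<close>
  have "\<Psi> (fiber (over W) s) = {x. norm (L (untwist i j (s 0) x)) < 1}" if s: "s \<in> extensional {0}" for s
  proof -
    have fr: "untwist i j (s 0) \<in> GL" by (rule untwist_GL[OF ij])
    then have A: "inv (untwist i j (s 0)) \<in> GL" by (rule GL_inv)
    have inv: "inv (inv (untwist i j (s 0))) = untwist i j (s 0)" using fr by (simp add: GL_def inv_inv_eq)
    have "fiber (over W) s = inv (untwist i j (s 0)) ` quartic_body i j"
      unfolding GL_image_eq[OF A] inv fib[OF s] by (simp add: quartic_body_def)
    then have "\<Psi> (fiber (over W) s) = inv (untwist i j (s 0)) ` \<Psi> (quartic_body i j)"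
      using equivariant[OF quartic_body_strongly_convex A] by simp
    then show ?thesis
      unfolding GL_image_eq[OF A] inv L(2) by simp
  qed
  then have E: "(\<Union>s\<in>points complex_line. {s} \<times> \<Psi> (fiber (over W) s)) = over W'"
    unfolding points_complex_line by (auto simp: over_def to_model_def W'_def)
  have "\<not> stein_manifold (mfd_over W')"
    unfolding W'_def by (rule not_stein_ellipsoid_family[OF ij L(1,3,4)])
  then have "\<not> pseudoconvex_family complex_line (over W')"
    by (simp add: pseudoconvex_family_def mfd_over_def)
  then show ?thesis
    using complex_manifold_complex_line X nbhd E
    by (intro exI[of _ complex_line] exI[of _ "over W"]) (simp add: points_complex_line)
qed

end
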